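(* Let $n\ge2$ and $R,\lambda>0$. For $t\in I(R)=\left[0,\frac{R^2}{2(n-1)}\right]$ set $$A_t(R,\lambda)=\left\{x\in\mathbb{R}^n\colon R-\tfrac{\pi}{2\lambda}<\sqrt{|x|^2+2(n-1)t}<R+\tfrac{\pi}{2\lambda}\right\}.$$ Let $(u,\Omega)$ be a mean curvature flow without singularities in $\mathbb{R}^{n+1}$. Suppose $A_0(R,\lambda)\Subset\Omega_0$ and $$u(x,0)\le-\frac1\lambda\log\cos\big[\lambda(|x|-R)\big]\qquad\text{for all }x\in A_0(R,\lambda).$$ Then for all $t\in I(R)$ one has $A_t(R,\lambda)\Subset\Omega_t$ and $$u(x,t)\le-\frac1\lambda\log\cos\left[\lambda\left(\sqrt{|x|^2+2(n-1)t}-R\right)\right]+\lambda t+f(t)\qquad\text{for all }x\in A_t(R,\lambda),$$ where $f$ can be taken to be either of the two functions $$f(t)=\sqrt{\frac{2\lambda}{\pi R}}\;t$$ or $$f(t)=\frac{2\left(R+\frac{\pi}{4\lambda}\right)}{n-1}\left[-\log\sin\left(\frac14\left(1-\frac{2(n-1)t}{\left(R+\frac{\pi}{4\lambda}\right)^2}\right)\right)+\log\sin\left(\frac14\right)\right].$$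
   Context: $A\Subset B$ means that $\overline A$ is compact and contained in $B$. Initial data: $\Omega_0\subset\mathbb{R}^n$ is open and $u_0\colon\Omega_0\to\mathbb{R}$ is locally Lipschitz continuous and has a continuous extension $\overline{u}_0\colon\mathbb{R}^n\to[-\infty,\infty]$ with $\{x:-\infty<\overline u_0(x)<\infty\}=\Omega_0$ and $\overline u_0|_{\Omega_0}=u_0$. A mean curvature flow without singularities with initial data $(u_0,\Omega_0)$ is a pair $(u,\Omega)$ of a relatively open set $\Omega\subset\mathbb{R}^n\times[0,\infty)$ and a continuous function $u\colon\Omega\to\mathbb{R}$ such that: with time slices $\Omega_t$ defined by $\Omega=\bigcup_{t\ge0}\Omega_t\times\{t\}$, the zero time slice is $\Omega_0$ and $u(\cdot,0)=u_0$; (maximality) there is a continuous function $\overline u\colon\mathbb{R}^n\times[0,\infty)\to[-\infty,\infty]$ with $\{(x,t):-\infty<\overline u(x,t)<\infty\}=\Omega$ and $\overline u|_\Omega=u$; (equation) on $\Omega\setminus(\Omega_0\times\{0\})$ the function $u$ is smooth and satisfies $\partial_tu=\left(\delta^{ij}-\frac{u^iu^j}{1+|Du|^2}\right)u_{ij}$ (summation convention). *)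

theory Defs
  imports "HOL-Analysis.Analysis"
begin

definition compactly_contained :: "'a::topological_space set \<Rightarrow> 'a set \<Rightarrow> bool"
    (infix "\<Subset>" 50) where
  "A \<Subset> B \<longleftrightarrow> compact (closure A) \<and> closure A \<subseteq> B"

(* C^k regularity and smoothness via iterated Frechet derivatives. Since the
   derivative is taken at a point, not within S, these are meant for open sets S. *)

fun C_on :: "nat \<Rightarrow> 'a::real_normed_vector set \<Rightarrow> ('a \<Rightarrow> 'b::real_normed_vector) \<Rightarrow> bool" where
  "C_on 0 S f \<longleftrightarrow> continuous_on S f"
| "C_on (Suc k) S f \<longleftrightarrow>
     (\<forall>p\<in>S. f differentiable (at p)) \<and>
     (\<forall>v. C_on k S (\<lambda>p. frechet_derivative f (at p) v))"

definition smooth_on :: "'a::real_normed_vector set \<Rightarrow> ('a \<Rightarrow> 'b::real_normed_vector) \<Rightarrow> bool" where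
  "smooth_on S f \<longleftrightarrow> (\<forall>k. C_on k S f)"

text \<open>Points of space-time are pairs \<open>(x, t)\<close>.\<close>

definition time_deriv :: "((real^'n) \<times> real \<Rightarrow> real) \<Rightarrow> (real^'n) \<times> real \<Rightarrow> real" where
  "time_deriv u p = frechet_derivative u (at p) (0, 1)"

definition space_deriv :: "'n \<Rightarrow> ((real^'n) \<times> real \<Rightarrow> real) \<Rightarrow> (real^'n) \<times> real \<Rightarrow> real" where
  "space_deriv i u p = frechet_derivative u (at p) (axis i 1, 0)"

definition space_gradient :: "((real^'n) \<times> real \<Rightarrow> real) \<Rightarrow> (real^'n) \<times> real \<Rightarrow> real^'n" where
  "space_gradient u p = (\<chi> i. space_deriv i u p)"

definition graphical_mcf_at :: "((real^'n) \<times> real \<Rightarrow> real) \<Rightarrow> (real^'n) \<times> real \<Rightarrow> bool" where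
  "graphical_mcf_at u p \<longleftrightarrow>
     time_deriv u p =
       (\<Sum>i\<in>UNIV. \<Sum>j\<in>UNIV.
          ((if i = j then 1 else 0)
            - space_deriv i u p * space_deriv j u p / (1 + (norm (space_gradient u p))\<^sup>2))
          * space_deriv j (space_deriv i u) p)"

(* Functions are total in HOL: the values of u0 outside Omega0, and those of u outside
   Omega, are arbitrary and play no role. The library notion local_lipschitz concerns
   families of functions; here it is applied to a one-member family. *)

definition mcf_initial_data :: "(real^'n \<Rightarrow> real) \<Rightarrow> (real^'n) set \<Rightarrow> bool" where
  "mcf_initial_data u0 \<Omega>0 \<longleftrightarrow>
     open \<Omega>0 \<and>
     local_lipschitz {0::real} \<Omega>0 (\<lambda>_. u0) \<and>
     (\<exists>ubar :: real^'n \<Rightarrow> ereal.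
        continuous_on UNIV ubar \<and>
        {x. -\<infinity> < ubar x \<and> ubar x < \<infinity>} = \<Omega>0 \<and>
        (\<forall>x\<in>\<Omega>0. ubar x = ereal (u0 x)))"

definition time_slice :: "((real^'n) \<times> real) set \<Rightarrow> real \<Rightarrow> (real^'n) set" where
  "time_slice \<Omega> t = {x. (x, t) \<in> \<Omega>}"

definition mcf_without_singularities ::
    "(real^'n \<Rightarrow> real) \<Rightarrow> (real^'n) set \<Rightarrow>
     ((real^'n) \<times> real \<Rightarrow> real) \<Rightarrow> ((real^'n) \<times> real) set \<Rightarrow> bool" where
  "mcf_without_singularities u0 \<Omega>0 u \<Omega> \<longleftrightarrow>
     mcf_initial_data u0 \<Omega>0 \<and>
     openin (top_of_set (UNIV \<times> {0..})) \<Omega> \<and>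
     continuous_on \<Omega> u \<and>
     time_slice \<Omega> 0 = \<Omega>0 \<and>
     (\<forall>x\<in>\<Omega>0. u (x, 0) = u0 x) \<and>
     (\<exists>ubar :: (real^'n) \<times> real \<Rightarrow> ereal.
        continuous_on (UNIV \<times> {0..}) ubar \<and>
        {p \<in> UNIV \<times> {0..}. -\<infinity> < ubar p \<and> ubar p < \<infinity>} = \<Omega> \<and>
        (\<forall>p\<in>\<Omega>. ubar p = ereal (u p))) \<and>
     smooth_on (\<Omega> - \<Omega>0 \<times> {0}) u \<and>
     (\<forall>p \<in> \<Omega> - \<Omega>0 \<times> {0}. graphical_mcf_at u p)"

definition evolving_annulus :: "real \<Rightarrow> real \<Rightarrow> real \<Rightarrow> (real^'n) set" where
  "evolving_annulus R lam t =
     {x. R - pi / (2 * lam) < sqrt ((norm x)\<^sup>2 + 2 * (real CARD('n) - 1) * t) \<and>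
         sqrt ((norm x)\<^sup>2 + 2 * (real CARD('n) - 1) * t) < R + pi / (2 * lam)}"

end

theory Submission
  imports Defs
begin

text \<open>
Put \<open>m = n - 1\<close>, \<open>s = sqrt (|x|\<^sup>2 + 2 m t)\<close> and \<open>\<theta> = lam * (s - R)\<close>. The level sets of \<open>s\<close> are spheres shrinking
by their mean curvature, and \<open>- ln (cos \<theta>) / lam + lam * t\<close> is the grim reaper of width \<open>\<pi> / lam\<close>
in the variable \<open>s - R\<close>, rotated about the axis \<open>x = 0\<close>. It solves the flow up to the error made by
identifying \<open>s\<close> with \<open>|x|\<close>, and the additional term \<open>f t\<close> makes it a strict supersolution as long as
\<open>2 m t \<le> R\<^sup>2\<close> (\<open>linear_drift_admissible\<close>, \<open>log_sin_drift_admissible\<close>).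

A direct comparison with this barrier fails: the barrier is infinite on the lateral boundary of the
tube, where the extended flow might become infinite at the same moment, so that the first contact
need not take place at a finite height. The barrier is therefore exhausted by compact ones, obtained
from the Angenent ovals in place of the grim reaper:
\<open>exp (lam\<^sup>2 t + lam f t) * (a * exp (- lam y) + b * exp (lam y)) \<le> cos \<theta>\<close>.
For \<open>b\<close> tending to \<open>0\<close> these sets fill the region above the barrier. Being compact, they have a first
contact with the graph at a finite height (\<open>oval_avoidance\<close>), and the maximum principle excludes this
contact (\<open>no_first_contact\<close>). At a contact on the axis \<open>x = 0\<close> at the moment when the oval pinches off
there, the first-order conditions degenerate and the Hessian in a direction orthogonal to the gradient
of \<open>u\<close> gives the contradiction; this uses \<open>n \<ge> 2\<close> and \<open>2 m t \<le> R\<^sup>2\<close>.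

That the graph avoids an oval does not by itself say on which side it lies, since the flow could also
have become infinite. Along the curves of constant \<open>s\<close> the extended flow is a continuous path in the
extended reals which avoids every height above the barrier, and it starts below
(\<open>oval_level_not_crossed\<close>). This gives the upper bound (\<open>annulus_barrier_above\<close>). Ovals below the graph
bound it from below (\<open>annulus_barrier_below\<close>). Both bounds, applied to a slightly wider annulus,
show that the flow is finite on the closure of the annulus (\<open>annulus_stays_in_domain\<close>).
\<close>


section \<open>Second-order conditions at a minimum\<close>

text \<open>For a symmetric form this is the bound of the largest eigenvalue by the trace. Summing the values
of the form at the vectors \<open>d\<^sub>j e\<^sub>i - d\<^sub>i e\<^sub>j\<close> over all pairs \<open>i, j\<close> gives twice the difference of the two
sides.\<close>

lemma quadratic_form_le_trace:
  fixes Q :: "'n::finite \<Rightarrow> 'n \<Rightarrow> real" and d :: "real^'n"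
  assumes psd: "\<And>v::real^'n. 0 \<le> (\<Sum>i\<in>UNIV. \<Sum>j\<in>UNIV. v$i * v$j * Q i j)"
  shows "(\<Sum>i\<in>UNIV. \<Sum>j\<in>UNIV. d$i * d$j * Q i j) \<le> (norm d)\<^sup>2 * (\<Sum>i\<in>UNIV. Q i i)"
proof -
  let ?q = "\<Sum>i\<in>UNIV. \<Sum>j\<in>UNIV. d$i * d$j * Q i j"
  let ?tr = "\<Sum>i\<in>UNIV. Q i i"
  have norm_d: "(norm d)\<^sup>2 = (\<Sum>i\<in>UNIV. (d$i)\<^sup>2)"
    unfolding power2_norm_eq_inner inner_vec_def by (simp add: power2_eq_square)
  have bil: "(\<Sum>k\<in>UNIV. \<Sum>l\<in>UNIV.
        (\<alpha> * (if k = i then 1 else 0) + \<beta> * (if k = j then 1 else 0)) *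
        (\<alpha> * (if l = i then 1 else 0) + \<beta> * (if l = j then 1 else 0)) * Q k l)
      = \<alpha>\<^sup>2 * Q i i + \<beta>\<^sup>2 * Q j j + \<alpha> * \<beta> * (Q i j + Q j i)" for \<alpha> \<beta> :: real and i j
    by (simp add: algebra_simps sum.distrib if_distrib[of "\<lambda>z. _ * z"] power2_eq_square
        cong: if_cong flip: sum_distrib_left)
  have "0 \<le> (d$j)\<^sup>2 * Q i i + (d$i)\<^sup>2 * Q j j - d$i * d$j * (Q i j + Q j i)" for i j
    using psd[of "\<chi> k. d$j * (if k = i then 1 else 0) + (- d$i) * (if k = j then 1 else 0)"]
    unfolding vec_lambda_beta bil by (simp add: algebra_simps)
  then have "0 \<le> (\<Sum>i\<in>UNIV. \<Sum>j\<in>UNIV.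
      (d$j)\<^sup>2 * Q i i + (d$i)\<^sup>2 * Q j j - d$i * d$j * (Q i j + Q j i))"
    by (intro sum_nonneg) auto
  also have "\<dots> = (\<Sum>i\<in>UNIV. \<Sum>j\<in>UNIV. (d$j)\<^sup>2 * Q i i) + (\<Sum>i\<in>UNIV. \<Sum>j\<in>UNIV. (d$i)\<^sup>2 * Q j j)
      - ?q - (\<Sum>i\<in>UNIV. \<Sum>j\<in>UNIV. d$i * d$j * Q j i)"
    by (simp add: sum.distrib sum_subtractf algebra_simps)
  also have "(\<Sum>i\<in>UNIV. \<Sum>j\<in>UNIV. d$i * d$j * Q j i) = ?q"
    by (subst sum.swap) (simp add: mult.commute)
  also have "(\<Sum>i\<in>UNIV. \<Sum>j\<in>UNIV. (d$j)\<^sup>2 * Q i i) = (norm d)\<^sup>2 * ?tr"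
    unfolding norm_d by (subst sum.swap) (simp add: sum_product)
  also have "(\<Sum>i\<in>UNIV. \<Sum>j\<in>UNIV. (d$i)\<^sup>2 * Q j j) = (norm d)\<^sup>2 * ?tr"
    unfolding norm_d by (simp add: sum_product)
  finally show ?thesis by (simp add: mult.commute)
qed

lemma second_derivative_nonneg_at_local_min:
  fixes h h' :: "real \<Rightarrow> real"
  assumes "\<forall>\<^sub>F z in at 0. h 0 \<le> h z"
    and "\<forall>\<^sub>F z in nhds 0. (h has_real_derivative h' z) (at z)"
    and h2: "(h' has_real_derivative k) (at 0)"
  shows "h' 0 = 0" and "0 \<le> k"
proof -
  obtain e1 where e1: "e1 > 0" "\<And>z. \<bar>z\<bar> < e1 \<Longrightarrow> h 0 \<le> h z"
    using assms(1) unfolding eventually_at by (auto simp: dist_real_def) (metis order_refl)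
  obtain e2 where e2: "e2 > 0" "\<And>z. \<bar>z\<bar> < e2 \<Longrightarrow> (h has_real_derivative h' z) (at z)"
    using assms(2) unfolding eventually_nhds_metric by (auto simp: dist_real_def)
  show h0: "h' 0 = 0"
    using DERIV_local_min[of h "h' 0" 0 e1] e1 e2(2)[of 0] \<open>e2 > 0\<close> by auto
  show "0 \<le> k"
  proof (rule ccontr)
    assume "\<not> 0 \<le> k"
    then obtain e3 where e3: "e3 > 0" "\<And>z. 0 < z \<Longrightarrow> z < e3 \<Longrightarrow> h' z < 0"
      using has_real_derivative_neg_dec_right[OF h2] h0 by (metis UNIV_I add_0 not_le)
    define e where "e = min e1 (min e2 e3) / 2"
    have e: "0 < e" "e < e1" "e < e2" "e < e3" using e1(1) e2(1) e3(1) by (auto simp: e_def)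
    have "h e < h 0"
    proof (rule DERIV_neg_imp_decreasing_open[OF e(1)])
      show "\<exists>y. (h has_real_derivative y) (at z) \<and> y < 0" if "0 < z" "z < e" for z
        using that e e2(2)[of z] e3(2)[of z] by (intro exI[of _ "h' z"]) auto
      show "continuous_on {0..e} h"
        using e e2(2) by (intro continuous_at_imp_continuous_on ballI DERIV_isCont[OF e2(2)]) auto
    qed
    with e1(2)[of e] e show False by auto
  qed
qed

section \<open>Admissible drifts\<close>

lemma tan_le_double:
  fixes y :: real
  assumes "0 \<le> y" "y \<le> pi / 4"
  shows "tan y \<le> 2 * y"
proof -
  have "cos (pi / 3) \<le> cos y" using assms pi_gt3 by (intro cos_monotone_0_pi_le) auto
  then have c: "1 / 2 \<le> cos y" by (simp add: cos_60)
  have "sin y \<le> y" using assms sin_x_le_x by simp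
  also have "\<dots> \<le> 2 * y * cos y" using c assms mult_left_mono[OF c, of "2*y"] by simp
  finally show ?thesis using c by (simp add: tan_def divide_le_eq)
qed

lemma cot_ge_half_inverse:
  fixes y :: real
  assumes "0 < y" "y \<le> pi / 4"
  shows "1 / (2 * y) \<le> cot y"
proof -
  have s: "0 < sin y" "0 < cos y"
    using assms pi_gt3 by (auto intro: sin_gt_zero cos_gt_zero)
  have "sin y \<le> 2 * y * cos y"
    using tan_le_double[of y] assms s by (simp add: tan_def divide_le_eq)
  then show ?thesis using assms s by (simp add: cot_def field_simps)
qed

text \<open>The differential inequality that makes the barrier move at least as fast as mean curvature flow.
Here \<open>m = n - 1\<close>, \<open>s\<close> stands for \<open>sqrt (|x|\<^sup>2 + 2 m t)\<close>, and \<open>f'\<close> is the speed by which the barrier is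
lifted in addition to the speed \<open>lam\<close> of the grim reaper. Since \<open>1 - 2 m t / s\<^sup>2 = |x|\<^sup>2 / s\<^sup>2\<close>, the
right-hand factor is one plus the squared slope of \<open>- ln (cos (lam * (s - R))) / lam\<close> as a function of
\<open>x\<close>. The left-hand side is the error that arises because \<open>s\<close> and \<open>|x|\<close> differ.\<close>

definition admissible_drift :: "real \<Rightarrow> real \<Rightarrow> real \<Rightarrow> (real \<Rightarrow> real) \<Rightarrow> (real \<Rightarrow> real) \<Rightarrow> bool" where
  "admissible_drift m R lam f f' \<longleftrightarrow>
     f 0 = 0 \<and>
     (\<forall>t. 0 \<le> t \<longrightarrow> 2 * m * t \<le> R\<^sup>2 \<longrightarrow>
        (f has_real_derivative f' t) (at t) \<and> 0 < f' t \<and>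
        (\<forall>s > 0. 2 * m * t \<le> s\<^sup>2 \<longrightarrow> \<bar>lam * (s - R)\<bar> < pi / 2 \<longrightarrow>
           2 * m * t / s\<^sup>2 * (tan (lam * (s - R)) / s - lam)
             < f' t * (1 + (tan (lam * (s - R)))\<^sup>2 * (1 - 2 * m * t / s\<^sup>2))))"

text \<open>Only the points with \<open>lam * s < tan \<theta>\<close>, \<open>\<theta> = lam * (s - R)\<close>, are critical, and they satisfy \<open>\<theta> > 0\<close>; elsewhere
the left-hand side of the inequality is nonpositive. At critical points the factor \<open>2 m t / s\<^sup>2 \<le> 1\<close>
on the left is given away.\<close>

lemma admissible_driftI:
  assumes "f 0 = 0" "lam > 0" "R > 0" "m > 0"
    and "\<And>t. 0 \<le> t \<Longrightarrow> 2 * m * t \<le> R\<^sup>2 \<Longrightarrow> (f has_real_derivative f' t) (at t)"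
    and pos: "\<And>t. 0 \<le> t \<Longrightarrow> 2 * m * t \<le> R\<^sup>2 \<Longrightarrow> 0 < f' t"
    and main: "\<And>t \<theta> s. 0 \<le> t \<Longrightarrow> 2 * m * t \<le> R\<^sup>2 \<Longrightarrow> 0 < \<theta> \<Longrightarrow> \<theta> < pi / 2 \<Longrightarrow> s = R + \<theta> / lam \<Longrightarrow>
        lam * s < tan \<theta> \<Longrightarrow>
        tan \<theta> / s - lam < f' t * (1 + (tan \<theta>)\<^sup>2 * (1 - 2 * m * t / s\<^sup>2))"
  shows "admissible_drift m R lam f f'"
  unfolding admissible_drift_def
proof (intro conjI allI impI)
  fix t s :: real
  assume t: "0 \<le> t" "2 * m * t \<le> R\<^sup>2" and s: "0 < s" "2 * m * t \<le> s\<^sup>2" "\<bar>lam * (s - R)\<bar> < pi / 2"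
  define \<theta> where "\<theta> = lam * (s - R)"
  have seq: "s = R + \<theta> / lam" using \<open>lam > 0\<close> by (simp add: \<theta>_def)
  have q: "0 \<le> 2 * m * t / s\<^sup>2" "2 * m * t / s\<^sup>2 \<le> 1" using s t \<open>m > 0\<close> by auto
  show "2 * m * t / s\<^sup>2 * (tan (lam * (s - R)) / s - lam)
             < f' t * (1 + (tan (lam * (s - R)))\<^sup>2 * (1 - 2 * m * t / s\<^sup>2))"
    unfolding \<theta>_def[symmetric]
  proof (cases "lam * s < tan \<theta>")
    case True
    have "0 < tan \<theta>" using True s \<open>lam > 0\<close> by (smt (verit) mult_pos_pos)
    have "0 < \<theta>"
    proof (rule ccontr)
      assume "\<not> 0 < \<theta>"
      then have "tan \<theta> \<le> tan 0" using s(3) unfolding \<theta>_def[symmetric] by (intro tan_mono_le) auto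
      with \<open>0 < tan \<theta>\<close> show False by simp
    qed
    moreover have "\<theta> < pi / 2" using s(3) unfolding \<theta>_def[symmetric] by auto
    ultimately have m: "tan \<theta> / s - lam < f' t * (1 + (tan \<theta>)\<^sup>2 * (1 - 2 * m * t / s\<^sup>2))"
      using main[OF t _ _ seq True] by blast
    have "0 \<le> tan \<theta> / s - lam" using True s by (simp add: field_simps)
    then have "2 * m * t / s\<^sup>2 * (tan \<theta> / s - lam) \<le> tan \<theta> / s - lam"
      using q by (intro mult_left_le_one_le) auto
    with m show "2 * m * t / s\<^sup>2 * (tan \<theta> / s - lam)
             < f' t * (1 + (tan \<theta>)\<^sup>2 * (1 - 2 * m * t / s\<^sup>2))" by linarith
  next
    case False
    then have "2 * m * t / s\<^sup>2 * (tan \<theta> / s - lam) \<le> 0"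
      using s q by (intro mult_nonneg_nonpos) (auto simp: field_simps)
    also have "0 < f' t * (1 + (tan \<theta>)\<^sup>2 * (1 - 2 * m * t / s\<^sup>2))"
      using pos[OF t] q by (intro mult_pos_pos add_pos_nonneg mult_nonneg_nonneg) auto
    finally show "2 * m * t / s\<^sup>2 * (tan \<theta> / s - lam)
             < f' t * (1 + (tan \<theta>)\<^sup>2 * (1 - 2 * m * t / s\<^sup>2))" .
  qed
qed (use assms in auto)

text \<open>Write \<open>p = tan \<theta>\<close> and \<open>\<rho> = 1 - R\<^sup>2 / s\<^sup>2\<close>, which bounds \<open>|x|\<^sup>2 / s\<^sup>2\<close> from below because \<open>2 m t \<le> R\<^sup>2\<close>.
For \<open>\<theta> \<ge> \<pi> / 16\<close> the inequality \<open>1 + p\<^sup>2 \<rho> \<ge> 2 p sqrt \<rho>\<close> reduces the claim to \<open>4 k\<^sup>2 (s\<^sup>2 - R\<^sup>2) \<ge> 1\<close>, and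
\<open>s\<^sup>2 - R\<^sup>2 \<ge> 2 R \<theta> / lam\<close>. For smaller \<open>\<theta>\<close> a critical point forces \<open>lam * R < p - \<theta> \<le> \<theta>\<close>, so \<open>R\<close> is small
compared with \<open>1 / lam\<close> and the drift exceeds \<open>lam\<close>, while the left-hand side is at most \<open>lam\<close>.\<close>

lemma linear_drift_admissible:
  fixes m R lam :: real
  assumes m: "m > 0" and R: "R > 0" and lam: "lam > 0"
  shows "admissible_drift m R lam (\<lambda>t. sqrt (2 * lam / (pi * R)) * t) (\<lambda>_. sqrt (2 * lam / (pi * R)))"
proof (rule admissible_driftI[OF _ lam R m])
  define k where "k = sqrt (2 * lam / (pi * R))"
  have kpos: "0 < k" and k2: "k\<^sup>2 = 2 * lam / (pi * R)" using lam R by (auto simp: k_def)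
  show "0 < sqrt (2 * lam / (pi * R))" using kpos k_def by simp
  fix t \<theta> s :: real
  assume t: "0 \<le> t" "2 * m * t \<le> R\<^sup>2" and th: "0 < \<theta>" "\<theta> < pi / 2" and s: "s = R + \<theta> / lam"
    and steep: "lam * s < tan \<theta>"
  define p where "p = tan \<theta>"
  have sR: "R < s" using s th lam by simp
  then have sR: "R < s" "0 < s" using R by auto
  have ls: "lam * s = lam * R + \<theta>" using s lam by (simp add: field_simps)
  have p: "lam * R + \<theta> < p" "0 < p"
    using steep ls p_def th mult_pos_pos[OF lam R] by auto
  have rho: "1 - R\<^sup>2 / s\<^sup>2 \<le> 1 - 2 * m * t / s\<^sup>2" using t sR by (simp add: divide_right_mono)
  have s2: "s\<^sup>2 - R\<^sup>2 = 2 * R * \<theta> / lam + (\<theta> / lam)\<^sup>2"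
    by (simp add: s power2_eq_square algebra_simps)
  have "p / s - lam < k * (1 + p\<^sup>2 * (1 - R\<^sup>2 / s\<^sup>2))"
  proof (cases "pi / 16 \<le> \<theta>")
    case True
    define \<rho> where "\<rho> = 1 - R\<^sup>2 / s\<^sup>2"
    have rs: "\<rho> * s\<^sup>2 = s\<^sup>2 - R\<^sup>2" using sR by (simp add: \<rho>_def field_simps)
    have rpos: "0 \<le> \<rho>" using sR R by (simp add: \<rho>_def power_mono)
    have "1 \<le> 16 * \<theta> / pi" using True by (simp add: field_simps)
    also have "\<dots> = 4 * k\<^sup>2 * (2 * R * \<theta> / lam)" using lam R by (simp add: k2 field_simps)
    also have "\<dots> \<le> 4 * k\<^sup>2 * (\<rho> * s\<^sup>2)" unfolding rs s2 by (intro mult_left_mono) auto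
    also have "\<dots> = (2 * k * (sqrt \<rho> * s))\<^sup>2" using rpos by (simp add: power_mult_distrib)
    finally have "1 \<le> 2 * k * (sqrt \<rho> * s)"
      using kpos rpos sR by (intro power2_le_imp_le[of 1]) auto
    then have "p * 1 \<le> p * (2 * k * (sqrt \<rho> * s))" using p by (intro mult_left_mono) auto
    then have "p / s \<le> k * (2 * (p * sqrt \<rho>))" using sR by (simp add: field_simps)
    also have "\<dots> \<le> k * (1 + p\<^sup>2 * \<rho>)"
    proof (intro mult_left_mono)
      have "0 \<le> (1 - p * sqrt \<rho>)\<^sup>2" by simp
      then show "2 * (p * sqrt \<rho>) \<le> 1 + p\<^sup>2 * \<rho>" using rpos by (simp add: power2_diff power_mult_distrib)
    qed (use kpos in auto)
    finally show ?thesis using lam unfolding \<rho>_def by linarith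
  next
    case False
    have small: "\<theta> < 1 / 4" using False pi_less_4 by linarith
    have "p \<le> 2 * \<theta>" unfolding p_def using False th pi_gt3 by (intro tan_le_double) auto
    then have lR: "lam * R < \<theta>" using p by linarith
    have "p / s - lam \<le> lam"
    proof -
      have "p \<le> 2 * (lam * s)" using \<open>p \<le> 2 * \<theta>\<close> ls mult_pos_pos[OF lam R] by linarith
      then show ?thesis using sR by (simp add: field_simps)
    qed
    also have "lam < k"
    proof (rule power2_less_imp_less)
      have "lam * R * pi < 2"
        using lR small pi_less_4 mult_strict_mono[of "lam * R" "1/4" pi 4] lam R by simp
      then have "lam * (lam * R * pi) < lam * 2" using lam by (intro mult_strict_left_mono) auto
      then show "lam\<^sup>2 < k\<^sup>2" unfolding k2 using lam R by (simp add: power2_eq_square field_simps)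
    qed (use kpos in auto)
    also have "k * 1 \<le> k * (1 + p\<^sup>2 * (1 - R\<^sup>2 / s\<^sup>2))"
      using kpos sR R by (intro mult_left_mono) (auto simp: power_mono)
    finally show ?thesis by simp
  qed
  also have "\<dots> \<le> k * (1 + p\<^sup>2 * (1 - 2 * m * t / s\<^sup>2))"
    using rho kpos by (intro mult_left_mono add_left_mono) auto
  finally show "tan \<theta> / s - lam < sqrt (2 * lam / (pi * R)) * (1 + (tan \<theta>)\<^sup>2 * (1 - 2 * m * t / s\<^sup>2))"
    by (simp add: p_def k_def)
qed (auto intro!: derivative_eq_intros)

text \<open>The radius \<open>a\<close> is the one at which \<open>\<theta> = \<pi> / 4\<close>. For smaller \<open>\<theta>\<close> the slope \<open>tan \<theta>\<close> is at most \<open>2 \<theta>\<close> and a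
drift of size \<open>2 / a\<close> is enough. For larger \<open>\<theta>\<close> one has \<open>s \<ge> a\<close>, hence \<open>|x|\<^sup>2 / s\<^sup>2 \<ge> z\<close> with
\<open>z = 1 - 2 m t / a\<^sup>2\<close>, and \<open>cot (z / 4) \<ge> 2 / z\<close> compensates the small factor \<open>z\<close>.\<close>

lemma log_sin_drift_admissible:
  fixes m R lam :: real
  assumes m: "m > 0" and R: "R > 0" and lam: "lam > 0"
  defines "a \<equiv> R + pi / (4 * lam)"
  shows "admissible_drift m R lam
    (\<lambda>t. 2 * a / m * (- ln (sin (1/4 * (1 - 2 * m * t / a\<^sup>2))) + ln (sin (1/4))))
    (\<lambda>t. 1 / a * cot (1/4 * (1 - 2 * m * t / a\<^sup>2)))"
proof (rule admissible_driftI[OF _ lam R m])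
  have a: "R < a" "0 < a" using R lam by (auto simp: a_def intro!: add_pos_pos)
  fix t :: real
  assume t: "0 \<le> t" "2 * m * t \<le> R\<^sup>2"
  define z where "z = 1 - 2 * m * t / a\<^sup>2"
  have "R\<^sup>2 < a\<^sup>2" using a R by (intro power_strict_mono) auto
  then have z: "0 < z" "z \<le> 1" using t m a by (auto simp: z_def)
  have sz: "0 < sin (1/4 * z)" "0 < cos (1/4 * z)"
    using z pi_gt3 by (auto intro!: sin_gt_zero cos_gt_zero)
  have cot_z: "2 / z \<le> cot (1/4 * z)"
    using cot_ge_half_inverse[of "1/4 * z"] z pi_gt3 by simp
  show "((\<lambda>t. 2 * a / m * (- ln (sin (1/4 * (1 - 2 * m * t / a\<^sup>2))) + ln (sin (1/4))))
      has_real_derivative 1 / a * cot (1/4 * (1 - 2 * m * t / a\<^sup>2))) (at t)"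
    using sz a m unfolding z_def
    by (auto intro!: derivative_eq_intros simp: cot_def field_simps power2_eq_square)
  have "0 < 2 / z" using z by simp
  then show "0 < 1 / a * cot (1/4 * (1 - 2 * m * t / a\<^sup>2))"
    using less_le_trans[OF _ cot_z] a unfolding z_def[symmetric] by (intro mult_pos_pos) auto
  fix \<theta> s :: real
  assume th: "0 < \<theta>" "\<theta> < pi / 2" and s: "s = R + \<theta> / lam" and steep: "lam * s < tan \<theta>"
  define p where "p = tan \<theta>"
  have sR: "R < s" using s th lam by simp
  then have sR: "R < s" "0 < s" using R by auto
  have p: "0 < p" using steep p_def sR mult_pos_pos[OF lam sR(2)] by linarith
  have la: "lam * a = lam * R + pi / 4" and ls: "lam * s = lam * R + \<theta>"
    using lam s by (auto simp: a_def field_simps)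
  define \<rho> where "\<rho> = 1 - 2 * m * t / s\<^sup>2"
  have rho: "0 \<le> \<rho>"
  proof -
    have "R\<^sup>2 \<le> s\<^sup>2" using sR R by (intro power_mono) auto
    then show ?thesis using t sR unfolding \<rho>_def by (simp add: field_simps)
  qed
  have "p / s - lam < 1 / a * (2 / z * (1 + p\<^sup>2 * \<rho>))"
  proof (cases "\<theta> < pi / 4")
    case True
    have "p \<le> 2 * \<theta>" unfolding p_def using True th by (intro tan_le_double) auto
    then have "a * p \<le> a * (2 * \<theta>)" using a by (intro mult_left_mono) auto
    moreover have "a * \<theta> \<le> s * (pi / 4)"
    proof -
      have "R * \<theta> \<le> R * (pi / 4)" using True R by (intro mult_left_mono) auto
      moreover have "a * \<theta> = R * \<theta> + pi * \<theta> / (4 * lam)" by (simp add: a_def algebra_simps)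
      moreover have "s * (pi / 4) = R * (pi / 4) + pi * \<theta> / (4 * lam)" by (simp add: s algebra_simps)
      ultimately show ?thesis by linarith
    qed
    ultimately have "a * p \<le> 2 * (s * (pi / 4))"
      by linarith
    also have "\<dots> \<le> 2 * s" using sR pi_less_4 by simp
    finally have "p / s \<le> 2 / a" using a sR by (simp add: field_simps)
    also have "\<dots> = 1 / a * (2 * 1)" by simp
    also have "\<dots> \<le> 1 / a * (2 / z * (1 + p\<^sup>2 * \<rho>))"
      using z a rho p by (intro mult_left_mono mult_mono) (auto simp: field_simps)
    finally show ?thesis using lam by linarith
  next
    case False
    then have "a \<le> s" unfolding a_def s using lam by (simp add: field_simps)
    then have "a\<^sup>2 \<le> s\<^sup>2" using a by (intro power_mono) auto
    then have zr: "z \<le> \<rho>" using t m a sR unfolding z_def \<rho>_def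
      by (auto intro!: divide_left_mono)
    have "p / s \<le> p / a" using p a \<open>a \<le> s\<close> by (intro divide_left_mono) auto
    also have "\<dots> \<le> 1 / a * (1 + p\<^sup>2)"
    proof -
      have "0 \<le> (1 - p)\<^sup>2" by simp
      then have "p \<le> 1 + p\<^sup>2" using p by (simp add: power2_diff)
      then show ?thesis using a by (simp add: divide_right_mono)
    qed
    also have "\<dots> \<le> 1 / a * (2 / z * (1 + p\<^sup>2 * \<rho>))"
    proof (intro mult_left_mono)
      have "z * (1 + p\<^sup>2) \<le> 1 + p\<^sup>2 * z" using z by (simp add: algebra_simps)
      also have "\<dots> \<le> 2 * (1 + p\<^sup>2 * \<rho>)"
        using mult_left_mono[OF zr, of "p\<^sup>2"] rho by (auto simp: add_nonneg_nonneg mult_nonneg_nonneg intro: order_trans)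
      finally show "1 + p\<^sup>2 \<le> 2 / z * (1 + p\<^sup>2 * \<rho>)" using z by (simp add: field_simps)
    qed (use a in auto)
    finally show ?thesis using lam by linarith
  qed
  also have "\<dots> \<le> 1 / a * (cot (1/4 * z) * (1 + p\<^sup>2 * \<rho>))"
    using cot_z a rho by (intro mult_left_mono mult_right_mono) auto
  finally show "tan \<theta> / s - lam < 1 / a * cot (1/4 * (1 - 2 * m * t / a\<^sup>2)) *
      (1 + (tan \<theta>)\<^sup>2 * (1 - 2 * m * t / s\<^sup>2))"
    by (simp add: p_def z_def \<rho>_def)
qed simp

section \<open>Derivatives along lines in space-time\<close>

lemma frechet_derivative_space_direction:
  fixes u :: "(real^'n) \<times> real \<Rightarrow> real"
  assumes "u differentiable (at p)"
  shows "frechet_derivative u (at p) (v, 0) = space_gradient u p \<bullet> v"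
proof -
  interpret linear "frechet_derivative u (at p)"
    using assms by (rule linear_frechet_derivative)
  have "(v, 0::real) = (\<Sum>i\<in>UNIV. v$i *\<^sub>R (axis i 1, 0))"
    using basis_expansion[of v] by (simp add: prod_eq_iff fst_sum snd_sum vector_scalar_mult_def scalar_mult_eq_scaleR)
  then have "frechet_derivative u (at p) (v, 0)
      = (\<Sum>i\<in>UNIV. v$i * frechet_derivative u (at p) (axis i 1, 0))"
    by (simp add: sum scale del: scaleR_Pair)
  then show ?thesis
    by (simp add: inner_vec_def space_gradient_def space_deriv_def mult.commute)
qed

lemma has_real_derivative_along_space_line:
  fixes u :: "(real^'n) \<times> real \<Rightarrow> real"
  assumes "u differentiable (at (x + z *\<^sub>R v, t))"
  shows "((\<lambda>z. u (x + z *\<^sub>R v, t)) has_real_derivative space_gradient u (x + z *\<^sub>R v, t) \<bullet> v) (at z)"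
proof -
  have line: "((\<lambda>z. (x + z *\<^sub>R v, t)) has_derivative (\<lambda>h. (h *\<^sub>R v, 0))) (at z)"
    by (auto intro!: derivative_eq_intros)
  have "((\<lambda>z. u (x + z *\<^sub>R v, t)) has_derivative
      (\<lambda>h. frechet_derivative u (at (x + z *\<^sub>R v, t)) (h *\<^sub>R v, 0))) (at z)"
    using diff_chain_at[OF line] assms by (simp add: frechet_derivative_works o_def)
  then show ?thesis
    by (simp add: frechet_derivative_space_direction[OF assms] has_field_derivative_def mult_commute_abs)
qed

lemma has_real_derivative_along_time:
  fixes u :: "(real^'n) \<times> real \<Rightarrow> real"
  assumes "u differentiable (at (x, t))"
  shows "((\<lambda>t. u (x, t)) has_real_derivative time_deriv u (x, t)) (at t)"
proof -
  interpret linear "frechet_derivative u (at (x, t))"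
    using assms by (rule linear_frechet_derivative)
  have line: "((\<lambda>t. (x, t)) has_derivative (\<lambda>h. (0, h))) (at t)"
    by (auto intro!: derivative_eq_intros)
  have "((\<lambda>t. u (x, t)) has_derivative (\<lambda>h. frechet_derivative u (at (x, t)) (0, h))) (at t)"
    using diff_chain_at[OF line] assms by (simp add: frechet_derivative_works o_def)
  moreover have "frechet_derivative u (at (x, t)) (0, h) = time_deriv u (x, t) * h" for h
    using scale[of h "(0, 1)"] by (simp add: time_deriv_def mult.commute)
  ultimately show ?thesis by (simp add: has_field_derivative_def)
qed

lemma has_real_derivative_directional_derivative:
  fixes u :: "(real^'n) \<times> real \<Rightarrow> real"
  assumes "\<And>i. space_deriv i u differentiable (at (x, t))"
  shows "((\<lambda>z. space_gradient u (x + z *\<^sub>R v, t) \<bullet> v) has_real_derivative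
      (\<Sum>i\<in>UNIV. \<Sum>j\<in>UNIV. v$i * v$j * space_deriv j (space_deriv i u) (x, t))) (at 0)"
proof -
  have "((\<lambda>z. space_deriv i u (x + z *\<^sub>R v, t)) has_real_derivative
      (\<Sum>j\<in>UNIV. space_deriv j (space_deriv i u) (x, t) * v$j)) (at 0)" for i
    using has_real_derivative_along_space_line[of "space_deriv i u" x 0 v t] assms[of i]
    by (simp add: space_gradient_def inner_vec_def)
  then have "((\<lambda>z. \<Sum>i\<in>UNIV. space_deriv i u (x + z *\<^sub>R v, t) * v$i) has_real_derivative
      (\<Sum>i\<in>UNIV. (\<Sum>j\<in>UNIV. space_deriv j (space_deriv i u) (x, t) * v$j) * v$i)) (at 0)"
    by (intro DERIV_sum DERIV_cmult_right)
  then show ?thesis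
    by (simp add: space_gradient_def inner_vec_def sum_distrib_left sum_distrib_right algebra_simps)
qed

text \<open>Clearing the denominator gives the equation the form in which the maximum principle uses it.\<close>

lemma graphical_mcf_at_iff:
  fixes u :: "(real^'n) \<times> real \<Rightarrow> real"
  defines "d p \<equiv> space_gradient u p" and "h p i j \<equiv> space_deriv j (space_deriv i u) p"
  shows "graphical_mcf_at u p \<longleftrightarrow>
    (1 + (norm (d p))\<^sup>2) * time_deriv u p
      = (1 + (norm (d p))\<^sup>2) * (\<Sum>i\<in>UNIV. h p i i) - (\<Sum>i\<in>UNIV. \<Sum>j\<in>UNIV. d p$i * d p$j * h p i j)"
proof -
  have "(\<Sum>i\<in>UNIV. \<Sum>j\<in>UNIV.
          ((if i = j then 1 else 0)
            - space_deriv i u p * space_deriv j u p / (1 + (norm (space_gradient u p))\<^sup>2))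
          * space_deriv j (space_deriv i u) p)
     = (\<Sum>i\<in>UNIV. \<Sum>j\<in>UNIV. (if i = j then h p i j else 0)
         - d p$i * d p$j * h p i j / (1 + (norm (d p))\<^sup>2))"
    unfolding d_def h_def space_gradient_def
    by (intro sum.cong refl) (simp add: algebra_simps)
  also have "\<dots> = (\<Sum>i\<in>UNIV. h p i i)
      - (\<Sum>i\<in>UNIV. \<Sum>j\<in>UNIV. d p$i * d p$j * h p i j) / (1 + (norm (d p))\<^sup>2)"
    by (simp add: sum_subtractf sum_divide_distrib)
  finally have eq: "graphical_mcf_at u p \<longleftrightarrow> time_deriv u p = (\<Sum>i\<in>UNIV. h p i i)
      - (\<Sum>i\<in>UNIV. \<Sum>j\<in>UNIV. d p$i * d p$j * h p i j) / (1 + (norm (d p))\<^sup>2)"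
    unfolding graphical_mcf_at_def by simp
  have "1 + (norm (d p))\<^sup>2 > 0" by (simp add: add_pos_nonneg)
  then show ?thesis unfolding eq by (simp add: field_simps)
qed

section \<open>First contact with the oval\<close>

text \<open>What remains of the first- and second-order conditions at a contact point once the second
derivatives of \<open>u\<close> are eliminated through the evolution equation. The premise \<open>hess\<close> is the Hessian of
\<open>- C (|x|\<^sup>2) + \<beta> (u)\<close> being nonnegative, with \<open>C1\<close>, \<open>C2\<close> the derivatives of \<open>C\<close> and \<open>b1\<close>, \<open>K\<close> those of
\<open>\<beta>\<close>; \<open>time\<close> is the corresponding sign of the time derivative. Tracing the Hessian with the
coefficients \<open>\<delta>\<^sub>i\<^sub>j - d\<^sub>i d\<^sub>j / (1 + |d|\<^sup>2)\<close> of the flow keeps it nonnegative and produces exactly \<open>ut\<close>.\<close>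

lemma contact_inequality:
  fixes x d :: "real^'n" and h :: "'n \<Rightarrow> 'n \<Rightarrow> real"
  assumes hess: "\<And>v. 0 \<le> - 4 * C2 * (x \<bullet> v)\<^sup>2 - 2 * C1 * (norm v)\<^sup>2 + K * (d \<bullet> v)\<^sup>2
        + b1 * (\<Sum>i\<in>UNIV. \<Sum>j\<in>UNIV. v$i * v$j * h i j)"
    and time: "G - 2 * (real CARD('n) - 1) * C1 + b1 * ut \<le> 0"
    and mcf: "(1 + (norm d)\<^sup>2) * ut
        = (1 + (norm d)\<^sup>2) * (\<Sum>i\<in>UNIV. h i i) - (\<Sum>i\<in>UNIV. \<Sum>j\<in>UNIV. d$i * d$j * h i j)"
  shows "G * (1 + (norm d)\<^sup>2) + 2 * C1
      + 4 * C2 * ((norm x)\<^sup>2 * (1 + (norm d)\<^sup>2) - (x \<bullet> d)\<^sup>2) - K * (norm d)\<^sup>2 \<le> 0"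
proof -
  define D where "D = (norm d)\<^sup>2"
  have dd: "(norm d)\<^sup>2 = D" "d \<bullet> d = D" by (simp_all add: D_def power2_norm_eq_inner)
  define H where "H i j = - 4 * C2 * (x$i * x$j) - 2 * C1 * (if i = j then 1 else 0) + K * (d$i * d$j)
      + b1 * h i j" for i j
  have sq: "(y \<bullet> v)\<^sup>2 = (\<Sum>i\<in>UNIV. \<Sum>j\<in>UNIV. v$i * v$j * (y$i * y$j))" for y v :: "real^'n"
    by (simp add: inner_vec_def power2_eq_square sum_product algebra_simps)
  have nsq: "(norm y)\<^sup>2 = (\<Sum>i\<in>UNIV. y$i * y$i)" for y :: "real^'n"
    by (simp add: power2_norm_eq_inner inner_vec_def)
  have form: "(\<Sum>i\<in>UNIV. \<Sum>j\<in>UNIV. v$i * v$j * H i j)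
      = - 4 * C2 * (x \<bullet> v)\<^sup>2 - 2 * C1 * (norm v)\<^sup>2 + K * (d \<bullet> v)\<^sup>2
        + b1 * (\<Sum>i\<in>UNIV. \<Sum>j\<in>UNIV. v$i * v$j * h i j)" for v :: "real^'n"
  proof -
    have "(\<Sum>i\<in>UNIV. \<Sum>j\<in>UNIV. v$i * v$j * H i j) = (\<Sum>i\<in>UNIV. \<Sum>j\<in>UNIV.
        (- 4 * C2) * (v$i * v$j * (x$i * x$j)) - 2 * C1 * (if i = j then v$i * v$j else 0)
        + K * (v$i * v$j * (d$i * d$j)) + b1 * (v$i * v$j * h i j))"
      by (intro sum.cong refl) (simp add: H_def algebra_simps)
    also have "\<dots> = - 4 * C2 * (x \<bullet> v)\<^sup>2 - 2 * C1 * (norm v)\<^sup>2 + K * (d \<bullet> v)\<^sup>2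
        + b1 * (\<Sum>i\<in>UNIV. \<Sum>j\<in>UNIV. v$i * v$j * h i j)"
      unfolding sq nsq sum.distrib sum_subtractf sum_distrib_left[symmetric] by simp
    finally show ?thesis .
  qed
  have psd: "0 \<le> (\<Sum>i\<in>UNIV. \<Sum>j\<in>UNIV. v$i * v$j * H i j)" for v :: "real^'n"
    unfolding form by (rule hess)
  have tr: "(\<Sum>i\<in>UNIV. H i i) = - 4 * C2 * (norm x)\<^sup>2 - 2 * C1 * real CARD('n) + K * D
      + b1 * (\<Sum>i\<in>UNIV. h i i)"
    unfolding H_def D_def nsq sum.distrib sum_subtractf sum_distrib_left[symmetric] by simp
  have "0 \<le> H i i" for i
    using psd[of "axis i 1"] by (simp add: axis_def if_distrib[of "\<lambda>z. z * _"] if_distrib[of "\<lambda>z. _ * z"] cong: if_cong)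
  then have "0 \<le> (\<Sum>i\<in>UNIV. H i i)" by (simp add: sum_nonneg)
  moreover have "(\<Sum>i\<in>UNIV. \<Sum>j\<in>UNIV. d$i * d$j * H i j) \<le> D * (\<Sum>i\<in>UNIV. H i i)"
    unfolding D_def by (rule quadratic_form_le_trace[OF psd])
  ultimately have "0 \<le> (1 + D) * (\<Sum>i\<in>UNIV. H i i) - (\<Sum>i\<in>UNIV. \<Sum>j\<in>UNIV. d$i * d$j * H i j)"
    by (simp add: algebra_simps)
  also have "\<dots> = - 4 * C2 * ((norm x)\<^sup>2 * (1 + D) - (x \<bullet> d)\<^sup>2)
      - 2 * C1 * (real CARD('n) * (1 + D) - D) + K * D + b1 * ((1 + D) * ut)"
    unfolding tr form mcf[folded D_def] dd
    by (simp add: algebra_simps power2_eq_square)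
  finally have 1: "0 \<le> \<dots>" .
  have "0 \<le> 1 + D" by (simp add: D_def)
  then have "(1 + D) * (G - 2 * (real CARD('n) - 1) * C1 + b1 * ut) \<le> 0"
    using time by (rule mult_nonneg_nonpos)
  with 1 show ?thesis unfolding D_def[symmetric] by (simp add: algebra_simps)
qed

text \<open>The vertical profile of the barrier. With \<open>a\<close>, \<open>b\<close> growing like \<open>exp (lam\<^sup>2 t)\<close>, the part of
the \<open>(z, y)\<close>-plane with \<open>oval lam a b y \<le> cos (lam * z)\<close> and \<open>|lam * z| < \<pi> / 2\<close> is the compact region
bounded by the Angenent oval, which shrinks by its curvature. For \<open>b = 0\<close> it is the region above a grim reaper.\<close>

definition oval :: "real \<Rightarrow> real \<Rightarrow> real \<Rightarrow> real \<Rightarrow> real" where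
  "oval lam a b y = a * exp (- (lam * y)) + b * exp (lam * y)"

lemma oval_pos: "a > 0 \<Longrightarrow> b > 0 \<Longrightarrow> 0 < oval lam a b y"
  by (simp add: oval_def add_pos_pos)

lemma oval_derivatives:
  shows "(oval lam a b has_real_derivative lam * oval lam (- a) b y) (at y)"
  unfolding oval_def by (auto intro!: derivative_eq_intros simp: algebra_simps)

text \<open>This is \<open>sinh\<^sup>2 = cosh\<^sup>2 - 1\<close> for the combination \<open>oval\<close>. It bounds the vertical slope by the value,
and it shows that the slope can vanish only where the value is \<open>2 * sqrt (a * b)\<close>.\<close>

lemma oval_slope_square:
  "(oval lam (- a) b y)\<^sup>2 = (oval lam a b y)\<^sup>2 - 4 * a * b"
proof -
  have "exp (- (lam * y)) * exp (lam * y) = 1" by (simp flip: exp_add)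
  then show ?thesis unfolding oval_def by algebra
qed

text \<open>The profile is differentiated in \<open>q = s\<^sup>2 = |x|\<^sup>2 + 2 m t\<close> instead of \<open>|x|\<close>, since \<open>q\<close> is smooth across
the axis \<open>x = 0\<close>.\<close>

lemma profile_derivatives:
  fixes lam R q :: real
  assumes "q > 0"
  shows "((\<lambda>q. cos (lam * (sqrt q - R))) has_real_derivative
      - (lam * sin (lam * (sqrt q - R)) / (2 * sqrt q))) (at q)" (is ?first)
    and "((\<lambda>q. - (lam * sin (lam * (sqrt q - R)) / (2 * sqrt q))) has_real_derivative
      - (lam\<^sup>2 * cos (lam * (sqrt q - R)) / (4 * q)) + lam * sin (lam * (sqrt q - R)) / (4 * q * sqrt q)) (at q)"
      (is ?second)
proof -
  have s: "sqrt q > 0" "sqrt q * sqrt q = q" using assms by simp_all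
  have ds: "(sqrt has_real_derivative 1 / (2 * sqrt q)) (at q)"
    using DERIV_real_sqrt[OF assms] by (simp add: field_simps)
  have cleanup: "- ((lam * (c * (lam * (1 / (2 * sqrt q) - 0))) * (2 * sqrt q)
       - lam * z * (2 * (1 / (2 * sqrt q)))) / (2 * sqrt q * (2 * sqrt q)))
      = - (lam\<^sup>2 * c / (4 * q)) + lam * z / (4 * q * sqrt q)" for c z :: real
  proof -
    define w where "w = sqrt q"
    have "w > 0" "q = w * w" using s by (simp_all add: w_def)
    then show ?thesis unfolding w_def[symmetric] by (simp add: field_simps power2_eq_square)
  qed
  show ?first
    by (rule derivative_eq_intros ds refl | use s assms in \<open>simp add: field_simps\<close>)+
  have num: "((\<lambda>q. lam * sin (lam * (sqrt q - R))) has_real_derivative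
      lam * (cos (lam * (sqrt q - R)) * (lam * (1 / (2 * sqrt q) - 0)))) (at q)"
    by (intro DERIV_cmult DERIV_fun_sin DERIV_diff ds DERIV_const)
  have den: "((\<lambda>q. 2 * sqrt q) has_real_derivative 2 * (1 / (2 * sqrt q))) (at q)"
    by (intro DERIV_cmult ds)
  show ?second
    using DERIV_minus[OF DERIV_divide[OF num den]] s unfolding cleanup by simp
qed

text \<open>If the surface of the oval is not vertical at the contact point (\<open>b1 \<noteq> 0\<close>), then \<open>d\<close> is a
multiple of \<open>x0\<close>, and the contact inequality becomes
\<open>f' * (1 + |d|\<^sup>2) \<le> (1 - \<rho>) * (tan \<theta> / s - lam)\<close> with \<open>\<rho> = |x0|\<^sup>2 / s\<^sup>2\<close>. Since \<open>|d|\<^sup>2 \<ge> (tan \<theta>)\<^sup>2 \<rho>\<close>, this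
contradicts the admissibility of the drift.

If \<open>b1 = 0\<close>, the spatial gradient of \<open>cos \<theta>\<close> vanishes as well. The bound on \<open>4 a b\<close>, which says that the
oval has not yet collapsed, excludes \<open>\<theta> = 0\<close>, so \<open>x0 = 0\<close>: the oval pinches off at the axis. Then
\<open>s \<le> R\<close> and \<open>F\<close> is strictly concave in every direction orthogonal to \<open>d\<close>. Such a direction exists in
dimension at least two, so \<open>F\<close> has no minimum there.\<close>

lemma no_first_contact:
  fixes x0 :: "real^'n" and u :: "(real^'n) \<times> real \<Rightarrow> real" and R lam a b t0 m :: real and f f' :: "real \<Rightarrow> real"
  defines "m \<equiv> real CARD('n) - 1"
  defines "F \<equiv> \<lambda>x t. exp (lam\<^sup>2 * t + lam * f t) * oval lam a b (u (x, t))
                    - cos (lam * (sqrt ((norm x)\<^sup>2 + 2 * m * t) - R))"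
  assumes n: "CARD('n) \<ge> 2" and R: "R > 0" and lam: "lam > 0" and a: "a > 0" and b: "b > 0"
    and drift: "admissible_drift m R lam f f'"
    and t0: "0 < t0" "2 * m * t0 \<le> R\<^sup>2"
    and inside: "\<bar>lam * (sqrt ((norm x0)\<^sup>2 + 2 * m * t0) - R)\<bar> < pi / 2"
    and small: "4 * a * b * (exp (lam\<^sup>2 * t0 + lam * f t0))\<^sup>2 < 1"
    and N: "open N" "(x0, t0) \<in> N"
    and diff: "\<And>p. p \<in> N \<Longrightarrow> u differentiable (at p)"
    and diff2: "\<And>i. space_deriv i u differentiable (at (x0, t0))"
    and mcf: "graphical_mcf_at u (x0, t0)"
    and contact: "F x0 t0 = 0"
    and space_min: "\<And>x. (x, t0) \<in> N \<Longrightarrow> 0 \<le> F x t0"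
    and before: "\<And>t. t < t0 \<Longrightarrow> (x0, t) \<in> N \<Longrightarrow> 0 \<le> F x0 t"
  shows False
proof -
  define s where "s = sqrt ((norm x0)\<^sup>2 + 2 * m * t0)"
  define \<theta> where "\<theta> = lam * (s - R)"
  define C1 where "C1 q = - (lam * sin (lam * (sqrt q - R)) / (2 * sqrt q))" for q
  define C2 where "C2 q = - (lam\<^sup>2 * cos (lam * (sqrt q - R)) / (4 * q))
    + lam * sin (lam * (sqrt q - R)) / (4 * q * sqrt q)" for q
  define q0 where "q0 = (norm x0)\<^sup>2 + 2 * m * t0"
  define E where "E = exp (lam\<^sup>2 * t0 + lam * f t0)"
  define U where "U = u (x0, t0)"
  define d where "d = space_gradient u (x0, t0)"
  define hs where "hs i j = space_deriv j (space_deriv i u) (x0, t0)" for i j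
  define b1 where "b1 = E * (lam * oval lam (- a) b U)"
  define c where "c = cos \<theta>"
  have m: "1 \<le> m" using n by (simp add: m_def)
  have dC: "((\<lambda>q. cos (lam * (sqrt q - R))) has_real_derivative C1 q) (at q)"
    and dC1: "(C1 has_real_derivative C2 q) (at q)" if "q > 0" for q
    using profile_derivatives[OF that, of lam R] unfolding C1_def[abs_def] C2_def by blast+
  have mt0: "0 < 2 * m * t0" using m t0 by simp
  have q_pos: "0 < (norm x)\<^sup>2 + 2 * m * t0" for x :: "real^'n"
    using mt0 by (simp add: add_nonneg_pos)
  have q0: "0 < q0" "s = sqrt q0" "s\<^sup>2 = q0" "0 < s"
    using q_pos[of x0] by (simp_all add: q0_def s_def)
  have th: "\<bar>\<theta>\<bar> < pi / 2" using inside by (simp add: \<theta>_def s_def)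
  have c: "0 < c" unfolding c_def using th by (intro cos_gt_zero_pi) auto
  have cE: "c = E * oval lam a b U"
    using contact by (simp add: F_def E_def U_def c_def \<theta>_def s_def)
  have Epos: "0 < E" by (simp add: E_def)

  have grad_hess: "b1 * (d \<bullet> v) = 2 * C1 q0 * (x0 \<bullet> v)"
      "0 \<le> - 4 * C2 q0 * (x0 \<bullet> v)\<^sup>2 - 2 * C1 q0 * (norm v)\<^sup>2 + (lam\<^sup>2 * c) * (d \<bullet> v)\<^sup>2
        + b1 * (\<Sum>i\<in>UNIV. \<Sum>j\<in>UNIV. v$i * v$j * hs i j)" for v :: "real^'n"
  proof -
    let ?x = "\<lambda>z. x0 + z *\<^sub>R v"
    let ?q = "\<lambda>z. (norm x0)\<^sup>2 + 2 * z * (x0 \<bullet> v) + z\<^sup>2 * (norm v)\<^sup>2 + 2 * m * t0"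
    define h' where "h' z = E * (lam * oval lam (- a) b (u (?x z, t0)) * (space_gradient u (?x z, t0) \<bullet> v))
        - C1 (?q z) * (2 * (x0 \<bullet> v) + 2 * z * (norm v)\<^sup>2)" for z
    define k where "k = E * (lam\<^sup>2 * oval lam a b U * (d \<bullet> v)\<^sup>2
          + lam * oval lam (- a) b U * (\<Sum>i\<in>UNIV. \<Sum>j\<in>UNIV. v$i * v$j * hs i j))
        - (C2 q0 * (2 * (x0 \<bullet> v))\<^sup>2 + C1 q0 * (2 * (norm v)\<^sup>2))"
    have q_eq: "(norm (?x z))\<^sup>2 + 2 * m * t0 = ?q z" for z
      by (simp only: power2_norm_eq_inner inner_add_left inner_add_right inner_scaleR_left
          inner_scaleR_right inner_commute[of v x0]) (simp add: algebra_simps power2_eq_square)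
    have q_pos': "0 < ?q z" for z using q_pos[of "?x z"] unfolding q_eq .
    have dq: "(?q has_real_derivative 2 * (x0 \<bullet> v) + 2 * z * (norm v)\<^sup>2) (at z)" for z
      by (auto intro!: derivative_eq_intros simp: algebra_simps)
    have "open ((\<lambda>z. (?x z, t0)) -` N)"
      by (intro open_vimage N continuous_intros)
    then have near: "\<forall>\<^sub>F z in nhds 0. (?x z, t0) \<in> N"
      using N(2) by (auto simp: eventually_nhds)
    have F_line: "F (?x z) t0 = E * oval lam a b (u (?x z, t0)) - cos (lam * (sqrt (?q z) - R))" for z
      unfolding F_def E_def q_eq by simp
    have "\<forall>\<^sub>F z in at 0. F (?x 0) t0 \<le> F (?x z) t0"
      using near space_min contact by (simp add: eventually_at_filter eventually_mono)
    moreover have "\<forall>\<^sub>F z in nhds 0. ((\<lambda>z. F (?x z) t0) has_real_derivative h' z) (at z)"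
      using near
    proof eventually_elim
      case (elim z)
      show ?case unfolding F_line h'_def
        by (intro DERIV_diff DERIV_cmult DERIV_chain2[OF oval_derivatives]
            has_real_derivative_along_space_line diff[OF elim] DERIV_chain2[OF dC] dq q_pos')
    qed
    moreover have "(h' has_real_derivative k) (at 0)"
    proof -
      have "((\<lambda>z. oval lam (- a) b (u (?x z, t0))) has_real_derivative
          lam * oval lam a b U * (d \<bullet> v)) (at 0)"
        using DERIV_chain2[OF oval_derivatives has_real_derivative_along_space_line, of u x0 0 v t0 lam "- a" b]
          diff[OF N(2)] by (simp add: U_def d_def)
      moreover have "((\<lambda>z. space_gradient u (?x z, t0) \<bullet> v) has_real_derivative
          (\<Sum>i\<in>UNIV. \<Sum>j\<in>UNIV. v$i * v$j * hs i j)) (at 0)"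
        unfolding hs_def by (rule has_real_derivative_directional_derivative[OF diff2])
      moreover have "((\<lambda>z. C1 (?q z)) has_real_derivative C2 q0 * (2 * (x0 \<bullet> v))) (at 0)"
        using DERIV_chain2[OF dC1 dq[of 0], OF q_pos'] by (simp add: q0_def)
      ultimately show ?thesis
        unfolding h'_def[abs_def] k_def
        by (auto intro!: derivative_eq_intros simp: U_def[symmetric] d_def[symmetric] q0_def
            power2_eq_square algebra_simps)
    qed
    ultimately have "h' 0 = 0" "0 \<le> k"
      using second_derivative_nonneg_at_local_min[of "\<lambda>z. F (?x z) t0" h' k] by blast+
    then show "b1 * (d \<bullet> v) = 2 * C1 q0 * (x0 \<bullet> v)"
      "0 \<le> - 4 * C2 q0 * (x0 \<bullet> v)\<^sup>2 - 2 * C1 q0 * (norm v)\<^sup>2 + (lam\<^sup>2 * c) * (d \<bullet> v)\<^sup>2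
        + b1 * (\<Sum>i\<in>UNIV. \<Sum>j\<in>UNIV. v$i * v$j * hs i j)"
      unfolding h'_def k_def b1_def cE U_def d_def q0_def
      by (simp_all add: algebra_simps power2_eq_square)
  qed

  have mt_le: "2 * m * t0 \<le> s\<^sup>2" unfolding q0(3) by (simp add: q0_def)
  have df: "(f has_real_derivative f' t0) (at t0)" and f'_pos: "0 < f' t0"
    and drift_bound: "2 * m * t0 / s\<^sup>2 * (tan \<theta> / s - lam)
             < f' t0 * (1 + (tan \<theta>)\<^sup>2 * (1 - 2 * m * t0 / s\<^sup>2))"
    using drift t0(2) less_imp_le[OF t0(1)] q0(4) mt_le th
    unfolding admissible_drift_def \<theta>_def by blast+

  have time: "(lam\<^sup>2 + lam * f' t0) * c - 2 * m * C1 q0 + b1 * time_deriv u (x0, t0) \<le> 0"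
  proof -
    have "((\<lambda>t. F x0 t) has_real_derivative
        exp (lam\<^sup>2 * t0 + lam * f t0) * (lam\<^sup>2 + lam * f' t0) * oval lam a b (u (x0, t0))
        + lam * oval lam (- a) b (u (x0, t0)) * time_deriv u (x0, t0) * exp (lam\<^sup>2 * t0 + lam * f t0)
        - C1 ((norm x0)\<^sup>2 + 2 * m * t0) * (2 * m)) (at t0)"
      unfolding F_def
      by (intro DERIV_diff DERIV_mult DERIV_chain2[OF oval_derivatives] DERIV_chain2[OF dC]
          has_real_derivative_along_time diff[OF N(2)] q_pos)
        (auto intro!: derivative_eq_intros df)
    also have "exp (lam\<^sup>2 * t0 + lam * f t0) * (lam\<^sup>2 + lam * f' t0) * oval lam a b (u (x0, t0))
        + lam * oval lam (- a) b (u (x0, t0)) * time_deriv u (x0, t0) * exp (lam\<^sup>2 * t0 + lam * f t0)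
        - C1 ((norm x0)\<^sup>2 + 2 * m * t0) * (2 * m)
      = (lam\<^sup>2 + lam * f' t0) * c - 2 * m * C1 q0 + b1 * time_deriv u (x0, t0)" (is "_ = ?D")
      unfolding cE b1_def U_def E_def q0_def by (simp add: algebra_simps)
    finally have dF: "((\<lambda>t. F x0 t) has_real_derivative ?D) (at t0)" .
    show ?thesis
    proof (rule ccontr)
      assume "\<not> ?thesis"
      then obtain e where e: "e > 0" "\<And>k. 0 < k \<Longrightarrow> k < e \<Longrightarrow> F x0 (t0 - k) < F x0 t0"
        using has_real_derivative_pos_inc_left[OF dF] by auto
      have "open ((\<lambda>t. (x0, t)) -` N)" by (intro open_vimage N continuous_intros)
      then obtain e' where e': "e' > 0" "\<And>t. \<bar>t - t0\<bar> < e' \<Longrightarrow> (x0, t) \<in> N"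
        using N(2) unfolding open_dist by (auto simp: dist_real_def)
      define k where "k = min e e' / 2"
      have "0 < k" "k < e" "k < e'" using e(1) e'(1) by (auto simp: k_def)
      then show False using e(2)[of k] before[of "t0 - k"] e'(2)[of "t0 - k"] contact by auto
    qed
  qed

  have slope: "b1\<^sup>2 = lam\<^sup>2 * (c\<^sup>2 - 4 * a * b * E\<^sup>2)"
    unfolding b1_def power_mult_distrib oval_slope_square cE by (simp add: algebra_simps)
  have grad: "b1 *\<^sub>R d = (2 * C1 q0) *\<^sub>R x0"
    by (rule vector_eq_ldot[THEN iffD1]) (use grad_hess(1) in \<open>auto simp: inner_commute\<close>)
  have C1s: "2 * C1 q0 = - (lam * sin \<theta> / s)" unfolding C1_def \<theta>_def q0(2) by simp
  show False
  proof (cases "b1 = 0")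
    case True
    then have "c\<^sup>2 = 4 * a * b * E\<^sup>2" using slope lam by simp
    then have "c\<^sup>2 < 1" using small by (simp add: E_def)
    then have "\<theta> \<noteq> 0" by (auto simp: c_def)
    have "- pi < \<theta>" "\<theta> < pi" using th pi_gt_zero by linarith+
    with \<open>\<theta> \<noteq> 0\<close> have "sin \<theta> \<noteq> 0" using sin_eq_0_pi by blast
    then have "C1 q0 \<noteq> 0" using C1s lam q0(4) by auto
    with grad True have "x0 = 0" by simp
    then have "s\<^sup>2 \<le> R\<^sup>2" unfolding q0(3) using t0 by (simp add: q0_def)
    then have "s \<le> R" using R by (auto intro: power2_le_imp_le)
    moreover have "s \<noteq> R" using \<open>\<theta> \<noteq> 0\<close> by (auto simp: \<theta>_def)
    ultimately have "\<theta> < 0" unfolding \<theta>_def using lam by (intro mult_pos_neg) auto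
    then have "sin \<theta> < 0" using th sin_gt_zero[of "- \<theta>"] by simp
    then have "0 < 2 * C1 q0" unfolding C1s using mult_pos_neg[OF lam] q0(4) by (simp add: divide_neg_pos)
    obtain v :: "real^'n" where v: "v \<noteq> 0" "orthogonal d v"
      using orthogonal_to_vector_exists[of d] n by auto
    have "0 \<le> - (2 * C1 q0) * (norm v)\<^sup>2"
      using grad_hess(2)[of v] v True \<open>x0 = 0\<close> by (simp add: orthogonal_def)
    then show False using \<open>0 < 2 * C1 q0\<close> v by (simp add: mult_le_0_iff)
  next
    case False
    define D where "D = (norm d)\<^sup>2"
    define r2 where "r2 = (norm x0)\<^sup>2"
    have d_par: "d = (2 * C1 q0 / b1) *\<^sub>R x0"
      using grad False by (metis divide_inverse_commute inverse_eq_divide left_inverse scaleR_one scaleR_scaleR)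
    have par: "(x0 \<bullet> d)\<^sup>2 = r2 * D"
    proof -
      define k where "k = 2 * C1 q0 / b1"
      have "x0 \<bullet> d = k * r2" "D = k\<^sup>2 * r2"
        unfolding D_def r2_def d_par k_def[symmetric]
        by (simp_all add: power_mult_distrib power2_norm_eq_inner)
      then show ?thesis by (simp add: power2_eq_square)
    qed
    have "(lam\<^sup>2 + lam * f' t0) * c * (1 + D) + 2 * C1 q0
      + 4 * C2 q0 * ((norm x0)\<^sup>2 * (1 + D) - (x0 \<bullet> d)\<^sup>2) - lam\<^sup>2 * c * D \<le> 0"
      unfolding D_def
      by (rule contact_inequality[OF grad_hess(2) time[unfolded m_def]])
        (use mcf in \<open>simp add: graphical_mcf_at_iff d_def hs_def\<close>)
    then have ineq: "lam * f' t0 * c * (1 + D) + lam\<^sup>2 * c + 2 * C1 q0 + 4 * C2 q0 * r2 \<le> 0"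
      unfolding par r2_def[symmetric] by (simp add: algebra_simps)
    define \<rho> where "\<rho> = 1 - 2 * m * t0 / s\<^sup>2"
    define p where "p = tan \<theta>"
    have sin: "sin \<theta> = p * c" using c by (simp add: p_def tan_def c_def)
    have r2: "r2 = \<rho> * s\<^sup>2" using q0 by (simp add: \<rho>_def r2_def q0_def field_simps)
    have "2 * C1 q0 + 4 * C2 q0 * r2 = lam * c * (- p / s - lam * \<rho> + p / s * \<rho>)"
      unfolding C1s unfolding C2_def unfolding q0(2)[symmetric]
      unfolding \<theta>_def[symmetric] c_def[symmetric] sin r2 unfolding q0(3)[symmetric]
      using q0(4) by (simp add: field_simps power2_eq_square)
    with ineq have "lam * c * (f' t0 * (1 + D) + lam - p / s - lam * \<rho> + p / s * \<rho>) \<le> 0"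
      by (simp add: algebra_simps power2_eq_square)
    then have "f' t0 * (1 + D) + lam - p / s - lam * \<rho> + p / s * \<rho> \<le> 0"
      using mult_pos_pos[OF mult_pos_pos[OF lam c]] by (meson not_le)
    then have main: "f' t0 * (1 + D) \<le> (1 - \<rho>) * (p / s - lam)"
      by (simp add: algebra_simps diff_divide_distrib)
    have "p\<^sup>2 * \<rho> \<le> D"
    proof -
      have "b1\<^sup>2 * D = (norm (b1 *\<^sub>R d))\<^sup>2" by (simp add: D_def power_mult_distrib)
      also have "\<dots> = (2 * C1 q0)\<^sup>2 * r2" unfolding grad r2_def by (simp add: power_mult_distrib)
      also have "\<dots> = (lam * c)\<^sup>2 * (p\<^sup>2 * \<rho>)"
        unfolding C1s sin r2 using q0(4) by (simp add: power2_eq_square)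
      finally have "(lam * c)\<^sup>2 * (p\<^sup>2 * \<rho>) = b1\<^sup>2 * D" ..
      also have "\<dots> \<le> (lam * c)\<^sup>2 * D"
        unfolding slope D_def using a b lam by (intro mult_right_mono) (auto simp: power_mult_distrib)
      finally show ?thesis using lam c by simp
    qed
    then have "f' t0 * (1 + p\<^sup>2 * \<rho>) \<le> f' t0 * (1 + D)"
      using f'_pos by simp
    with main drift_bound show False unfolding p_def \<rho>_def by simp
  qed
qed

section \<open>The graph avoids the moving oval\<close>

abbreviation (input) phase :: "real \<Rightarrow> real \<Rightarrow> (real^'n) \<Rightarrow> real \<Rightarrow> real" where
  "phase R lam x t \<equiv> lam * (sqrt ((norm x)\<^sup>2 + 2 * (real CARD('n) - 1) * t) - R)"

lemma evolving_annulus_iff: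
  assumes "lam > 0"
  shows "x \<in> evolving_annulus R lam t \<longleftrightarrow> \<bar>phase R lam x t\<bar> < pi / 2"
proof -
  have "\<bar>lam * (s - R)\<bar> < pi / 2 \<longleftrightarrow> R - pi / (2 * lam) < s \<and> s < R + pi / (2 * lam)" for s
  proof -
    have "\<bar>lam * (s - R)\<bar> < pi / 2 \<longleftrightarrow> \<bar>s - R\<bar> < pi / (2 * lam)"
      using assms by (simp add: abs_mult pos_less_divide_eq ac_simps)
    then show ?thesis by linarith
  qed
  then show ?thesis by (simp add: evolving_annulus_def)
qed

lemma admissible_drift_mono:
  assumes drift: "admissible_drift m R lam f f'" and "0 \<le> m" "0 \<le> t" "t \<le> T" "2 * m * T \<le> R\<^sup>2"
  shows "f t \<le> f T"
proof (rule DERIV_nonneg_imp_nondecreasing[OF \<open>t \<le> T\<close>])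
  fix z assume z: "t \<le> z" "z \<le> T"
  have "2 * m * z \<le> 2 * m * T" using z assms by (intro mult_left_mono) auto
  then have "0 \<le> z" "2 * m * z \<le> R\<^sup>2" using z assms by linarith+
  then show "\<exists>y. (f has_real_derivative y) (at z) \<and> 0 \<le> y"
    using drift unfolding admissible_drift_def by (blast intro: less_imp_le)
qed

lemma mcf_interior:
  fixes u :: "(real^'n) \<times> real \<Rightarrow> real"
  assumes flow: "mcf_without_singularities u0 \<Omega>0 u \<Omega>"
  defines "S \<equiv> \<Omega> \<inter> UNIV \<times> {0<..}"
  shows "open S"
    and "p \<in> S \<Longrightarrow> u differentiable (at p)"
    and "p \<in> S \<Longrightarrow> space_deriv i u differentiable (at p)"
    and "p \<in> S \<Longrightarrow> graphical_mcf_at u p"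
proof -
  obtain V where V: "open V" "\<Omega> = (UNIV \<times> {0..}) \<inter> V"
    using flow unfolding mcf_without_singularities_def openin_open by blast
  have "S = (UNIV \<times> {0<..}) \<inter> V" unfolding S_def V by auto
  then show "open S" using V(1) by (auto intro!: open_Times open_Int)
  have S: "S = \<Omega> - \<Omega>0 \<times> {0}"
    using flow V(2) unfolding S_def mcf_without_singularities_def time_slice_def by force
  have "smooth_on S u" and eq: "\<forall>p\<in>S. graphical_mcf_at u p"
    using flow unfolding S mcf_without_singularities_def by auto
  then have "C_on (Suc (Suc 0)) S u" unfolding smooth_on_def by blast
  then show "p \<in> S \<Longrightarrow> u differentiable (at p)" and "p \<in> S \<Longrightarrow> space_deriv i u differentiable (at p)"
    unfolding space_deriv_def[abs_def] by auto
  show "p \<in> S \<Longrightarrow> graphical_mcf_at u p" using eq by blast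
qed

text \<open>The points of the tube at which the graph meets the oval form a compact set: on the oval \<open>u\<close> is bounded
by constants that depend on \<open>a\<close> and \<open>b\<close> only, and it keeps away from the lateral boundary of the tube,
where the cosine vanishes. Hence there is a first such point, and it is an interior one with
positive time.\<close>

lemma oval_avoidance:
  fixes u :: "(real^'n) \<times> real \<Rightarrow> real" and R lam a b T :: real and f f' :: "real \<Rightarrow> real"
  defines "g \<equiv> \<lambda>t. lam\<^sup>2 * t + lam * f t"
  assumes n: "CARD('n) \<ge> 2" and R: "R > 0" and lam: "lam > 0" and a: "a > 0" and b: "b > 0"
    and drift: "admissible_drift (real CARD('n) - 1) R lam f f'"
    and flow: "mcf_without_singularities u0 \<Omega>0 u \<Omega>"
    and T: "2 * (real CARD('n) - 1) * T \<le> R\<^sup>2"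
    and small: "4 * a * b * (exp (g T))\<^sup>2 < 1"
    and init: "\<And>x. x \<in> evolving_annulus R lam 0 \<Longrightarrow> (x, 0) \<in> \<Omega> \<Longrightarrow>
                 cos (lam * (norm x - R)) < oval lam a b (u (x, 0))"
    and x: "x \<in> evolving_annulus R lam t" "(x, t) \<in> \<Omega>" and t: "0 \<le> t" "t \<le> T"
  shows "cos (phase R lam x t) < exp (g t) * oval lam a b (u (x, t))"
proof (rule ccontr)
  assume crossing: "\<not> ?thesis"
  define m where "m = real CARD('n) - 1"
  have m: "1 \<le> m" using n by (simp add: m_def)
  define ph where "ph p = lam * (sqrt ((norm (fst p))\<^sup>2 + 2 * m * snd p) - R)" for p :: "(real^'n) \<times> real"
  define F where "F p = exp (g (snd p)) * oval lam a b (u p) - cos (ph p)" for p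
  define Tube where "Tube = {p. 0 \<le> snd p \<and> snd p \<le> T \<and> \<bar>ph p\<bar> \<le> pi / 2}"
  define K where "K = {p \<in> Tube \<inter> \<Omega>. F p \<le> 0}"
  have ph_cont: "continuous_on A ph" for A
    unfolding ph_def by (intro continuous_intros)
  have f0: "f 0 = 0" using drift by (simp add: admissible_drift_def)
  have mT: "2 * m * t \<le> R\<^sup>2" if "t \<le> T" for t
  proof -
    have "2 * m * t \<le> 2 * m * T" using that m by (intro mult_left_mono) auto
    with T show ?thesis unfolding m_def by linarith
  qed
  have df: "(f has_real_derivative f' t) (at t)" if "0 \<le> t" "t \<le> T" for t
    using drift that mT unfolding admissible_drift_def m_def by blast
  have g_mono: "g t \<le> g T" if "0 \<le> t" "t \<le> T" for t
    unfolding g_def using that lam m T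
    by (intro add_mono mult_left_mono admissible_drift_mono[OF drift]) (auto simp: m_def)
  have g_nonneg: "0 \<le> g t" if "0 \<le> t" "t \<le> T" for t
  proof -
    have "f 0 \<le> f t"
      using that m mT[of t] by (intro admissible_drift_mono[OF drift]) (auto simp: m_def)
    then show ?thesis using that lam f0 by (simp add: g_def)
  qed
  have g_cont: "continuous_on {0..T} g"
    unfolding g_def by (intro continuous_intros continuous_at_imp_continuous_on ballI)
      (auto intro!: DERIV_isCont df)

  \<comment> \<open>\<open>F p \<le> 0\<close> forces each of the two summands of the oval to be at most \<open>1\<close>, hence \<open>ylo \<le> u p \<le> yhi\<close>. The contact set is
     cut out of the tube by the extended function because that one is continuous up to the boundary of \<open>\<Omega>\<close>.\<close>
  obtain ubar :: "(real^'n) \<times> real \<Rightarrow> ereal" where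
    ubar_cont: "continuous_on (UNIV \<times> {0..}) ubar" and
    ubar_fin: "{p \<in> UNIV \<times> {0..}. -\<infinity> < ubar p \<and> ubar p < \<infinity>} = \<Omega>" and
    ubar: "\<And>p. p \<in> \<Omega> \<Longrightarrow> ubar p = ereal (u p)" and u_cont: "continuous_on \<Omega> u"
    using flow unfolding mcf_without_singularities_def by blast
  define ylo where "ylo = ln a / lam"
  define yhi where "yhi = - ln b / lam"
  define K1 where "K1 = {p \<in> Tube. ubar p \<in> {ereal ylo..ereal yhi}}"
  have Tube_closed: "closed Tube"
  proof -
    have "Tube = {p. 0 \<le> snd p} \<inter> {p. snd p \<le> T} \<inter> {p. \<bar>ph p\<bar> \<le> pi / 2}"
      by (auto simp: Tube_def)
    then show ?thesis
      by (auto intro!: closed_Int closed_Collect_le continuous_intros ph_cont)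
  qed
  have "K1 = Tube \<inter> ubar -` {ereal ylo..ereal yhi}" by (auto simp: K1_def)
  moreover have Tube_sub: "Tube \<subseteq> UNIV \<times> {0..}" by (auto simp: Tube_def)
  ultimately have K1_closed: "closed K1"
    using continuous_closed_preimage[OF continuous_on_subset[OF ubar_cont] Tube_closed] by auto
  have K1_sub: "K1 \<subseteq> \<Omega>" unfolding ubar_fin[symmetric] using Tube_sub
    by (auto simp: K1_def intro: less_le_trans le_less_trans)
  have F_cont: "continuous_on (Tube \<inter> \<Omega>) F"
    unfolding F_def oval_def
    by (intro continuous_intros ph_cont continuous_on_subset[OF u_cont]
        continuous_on_compose2[OF g_cont continuous_on_snd[OF continuous_on_id]])
      (auto simp: Tube_def)
  have "K = K1 \<inter> F -` {..0}"
  proof -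
    have "p \<in> K1" if "p \<in> K" for p
    proof -
      have p: "p \<in> Tube" "p \<in> \<Omega>" "F p \<le> 0" using that by (auto simp: K_def)
      have "1 * oval lam a b (u p) \<le> exp (g (snd p)) * oval lam a b (u p)"
        using g_nonneg p oval_pos[OF a b, of lam "u p"]
        by (intro mult_right_mono) (auto simp: Tube_def)
      also have "\<dots> \<le> 1" using p(3) cos_le_one[of "ph p"] unfolding F_def by linarith
      finally have "oval lam a b (u p) \<le> 1" by simp
      moreover have "0 < a * exp (- (lam * u p))" "0 < b * exp (lam * u p)" using a b by auto
      ultimately have "a * exp (- (lam * u p)) \<le> 1" "b * exp (lam * u p) \<le> 1"
        unfolding oval_def by linarith+
      then have "ln (a * exp (- (lam * u p))) \<le> 0" "ln (b * exp (lam * u p)) \<le> 0"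
        using a b by (simp_all add: ln_le_zero_iff)
      then have "ln a - lam * u p \<le> 0" "ln b + lam * u p \<le> 0"
        using a b by (simp_all add: ln_mult)
      then show ?thesis using p lam by (auto simp: K1_def ubar ylo_def yhi_def field_simps)
    qed
    then show ?thesis using K1_sub by (auto simp: K_def K1_def)
  qed
  moreover have "closed (K1 \<inter> F -` {..0})"
    using K1_sub by (intro continuous_closed_preimage continuous_on_subset[OF F_cont] K1_closed)
      (auto simp: K1_def)
  ultimately have "closed K" by simp
  moreover have "bounded K"
  proof (rule bounded_subset)
    show "bounded (cball (0::real^'n) (R + pi / 2 / lam) \<times> {0..T})"
      by (intro bounded_Times) auto
    have "norm (fst p) \<le> R + pi / 2 / lam" if "p \<in> Tube" for p
    proof -
      have "norm (fst p) \<le> sqrt ((norm (fst p))\<^sup>2 + 2 * m * snd p)"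
        using that m by (intro real_le_rsqrt) (auto simp: Tube_def)
      moreover have "lam * (sqrt ((norm (fst p))\<^sup>2 + 2 * m * snd p) - R) \<le> pi / 2"
        using that by (auto simp: Tube_def ph_def)
      then have "sqrt ((norm (fst p))\<^sup>2 + 2 * m * snd p) - R \<le> pi / 2 / lam"
        using lam by (subst pos_le_divide_eq) (auto simp: mult.commute)
      ultimately show ?thesis by linarith
    qed
    then show "K \<subseteq> cball (0::real^'n) (R + pi / 2 / lam) \<times> {0..T}"
      by (fastforce simp: K_def Tube_def)
  qed
  ultimately have "compact K" by (simp add: compact_eq_bounded_closed)
  moreover have "(x, t) \<in> K"
    using crossing x t evolving_annulus_iff[OF lam, of x R t]
    by (auto simp: K_def Tube_def F_def ph_def m_def)
  ultimately have "\<exists>p0\<in>K. \<forall>p\<in>K. snd p0 \<le> snd p"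
    by (intro continuous_attains_inf) (auto intro!: continuous_intros)
  then obtain p0 where p0: "p0 \<in> K" "\<And>p. p \<in> K \<Longrightarrow> snd p0 \<le> snd p"
    by blast
  obtain x0 t0 where p0_eq: "p0 = (x0, t0)" by (cases p0)
  have in_K: "(x0, t0) \<in> \<Omega>" "0 \<le> t0" "t0 \<le> T" "\<bar>ph (x0, t0)\<bar> \<le> pi / 2" "F (x0, t0) \<le> 0"
    using p0 by (auto simp: p0_eq K_def Tube_def)
  have "0 < exp (g t0) * oval lam a b (u (x0, t0))" using oval_pos[OF a b] by simp
  then have "0 < cos (ph (x0, t0))" using in_K(5) by (simp add: F_def)
  then have "\<bar>ph (x0, t0)\<bar> \<noteq> pi / 2" by (metis cos_abs_real cos_pi_half less_irrefl)
  then have inside: "\<bar>ph (x0, t0)\<bar> < pi / 2" using in_K(4) by simp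
  have "t0 \<noteq> 0"
  proof
    assume "t0 = 0"
    then have "x0 \<in> evolving_annulus R lam 0"
      using inside by (simp add: evolving_annulus_iff[OF lam] ph_def)
    from init[OF this] show False using in_K \<open>t0 = 0\<close> f0 by (simp add: F_def ph_def g_def)
  qed
  then have t0: "0 < t0" using in_K by simp

  define N where "N = (\<Omega> \<inter> UNIV \<times> {0<..}) \<inter> {p. \<bar>ph p\<bar> < pi / 2}"
  note interior = mcf_interior[OF flow]
  have N_open: "open N"
    unfolding N_def by (intro open_Int interior open_Collect_less continuous_intros ph_cont)
  have N_mem: "(x0, t0) \<in> N" using t0 in_K inside by (simp add: N_def)
  have before: "0 < F (z, s)" if "(z, s) \<in> N" "s < t0" for z s
  proof (rule ccontr)
    assume "\<not> 0 < F (z, s)"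
    with that in_K have "(z, s) \<in> K" by (auto simp: K_def Tube_def N_def)
    with p0(2)[of "(z, s)"] that show False by (simp add: p0_eq)
  qed
  have at_t0: "0 \<le> F (z, t0)" if zN: "(z, t0) \<in> N" for z
  proof -
    have "open ((\<lambda>s. (z, s)) -` N)" by (intro open_vimage N_open continuous_intros)
    then have "\<forall>\<^sub>F s in nhds t0. (z, s) \<in> N" using zN by (auto simp: eventually_nhds)
    then have "\<forall>\<^sub>F s in at_left t0. (z, s) \<in> N \<and> s < t0"
      by (simp add: eventually_at_filter eventually_mono)
    then have "\<forall>\<^sub>F s in at_left t0. 0 \<le> F (z, s)"
      by eventually_elim (auto dest: before)
    moreover have "isCont (\<lambda>s. F (z, s)) t0"
    proof -
      have "isCont (\<lambda>s. u (z, s)) t0"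
        using has_real_derivative_along_time interior(2)[of "(z, t0)"] zN
        by (intro DERIV_isCont) (auto simp: N_def)
      moreover have "isCont f t0" using df in_K by (blast intro: DERIV_isCont)
      ultimately show ?thesis unfolding F_def oval_def ph_def g_def by (auto intro!: continuous_intros)
    qed
    then have "((\<lambda>s. F (z, s)) \<longlongrightarrow> F (z, t0)) (at_left t0)"
      by (simp add: isCont_def filterlim_at_split)
    ultimately show ?thesis by (intro tendsto_lowerbound) auto
  qed
  have contact: "F (x0, t0) = 0" using at_t0[OF N_mem] in_K by simp
  have "4 * a * b * (exp (g t0))\<^sup>2 \<le> 4 * a * b * (exp (g T))\<^sup>2"
    using g_mono[of t0] in_K a b by (intro mult_left_mono power_mono) auto
  then have small_t0: "4 * a * b * (exp (lam\<^sup>2 * t0 + lam * f t0))\<^sup>2 < 1"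
    using small by (simp add: g_def)
  have N_int: "p \<in> \<Omega> \<inter> UNIV \<times> {0<..}" if "p \<in> N" for p using that by (simp add: N_def)
  show False
  proof (rule no_first_contact[OF n R lam a b drift t0 _ _ small_t0 N_open N_mem])
    show "2 * (real CARD('n) - 1) * t0 \<le> R\<^sup>2" using mT in_K by (simp add: m_def)
    show "\<bar>phase R lam x0 t0\<bar> < pi / 2" using inside by (simp add: ph_def m_def)
    show "u differentiable (at p)" if "p \<in> N" for p using N_int[OF that] by (rule interior)
    show "space_deriv i u differentiable (at (x0, t0))" for i using N_int[OF N_mem] by (rule interior)
    show "graphical_mcf_at u (x0, t0)" using N_int[OF N_mem] by (rule interior)
  qed (use contact at_t0 before in \<open>auto simp: F_def ph_def g_def m_def intro: less_imp_le\<close>)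
qed

lemma unit_direction:
  fixes x :: "'a::euclidean_space"
  obtains w where "norm w = 1" "x = norm x *\<^sub>R w"
proof (cases "x = 0")
  case True
  obtain w :: 'a where "norm w = 1" using vector_choose_size[of 1] by auto
  with True that show thesis by simp
next
  case False
  then show thesis using that[of "x /\<^sub>R norm x"] by simp
qed

section \<open>Barriers above and below\<close>

text \<open>The maximality condition, for a given extension.\<close>

definition extended_flow :: "((real^'n) \<times> real \<Rightarrow> real) \<Rightarrow> ((real^'n) \<times> real) set \<Rightarrow>
    ((real^'n) \<times> real \<Rightarrow> ereal) \<Rightarrow> bool" where
  "extended_flow u \<Omega> ubar \<longleftrightarrow> continuous_on (UNIV \<times> {0..}) ubar \<and>
     {p \<in> UNIV \<times> {0..}. -\<infinity> < ubar p \<and> ubar p < \<infinity>} = \<Omega> \<and> (\<forall>p\<in>\<Omega>. ubar p = ereal (u p))"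

text \<open>Avoiding the oval separates heights below it from heights above it only as long as the extended
function takes real values. Following the point \<open>x\<close> back to time \<open>0\<close> along a curve with constant \<open>s\<close>,
the extended function varies continuously in the extended reals and never takes the value \<open>y\<close>, so it
stays on the side on which it starts. In particular it cannot jump to infinity.\<close>

lemma oval_level_not_crossed:
  fixes u :: "(real^'n) \<times> real \<Rightarrow> real" and R lam a b t y :: real and f f' :: "real \<Rightarrow> real"
  defines "g \<equiv> \<lambda>t. lam\<^sup>2 * t + lam * f t"
  assumes n: "CARD('n) \<ge> 2" and R: "R > 0" and lam: "lam > 0" and a: "a > 0" and b: "b > 0"
    and drift: "admissible_drift (real CARD('n) - 1) R lam f f'"
    and flow: "mcf_without_singularities u0 \<Omega>0 u \<Omega>" and ext: "extended_flow u \<Omega> ubar"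
    and t: "0 \<le> t" "2 * (real CARD('n) - 1) * t \<le> R\<^sup>2"
    and small: "4 * a * b * (exp (g t))\<^sup>2 < 1"
    and init: "\<And>x. x \<in> evolving_annulus R lam 0 \<Longrightarrow> (x, 0) \<in> \<Omega> \<Longrightarrow>
                 cos (lam * (norm x - R)) < oval lam a b (u (x, 0))"
    and x: "x \<in> evolving_annulus R lam t"
    and y: "exp (g t) * oval lam a b y \<le> cos (phase R lam x t)"
  obtains z where "z \<in> evolving_annulus R lam 0" "norm z = sqrt ((norm x)\<^sup>2 + 2 * (real CARD('n) - 1) * t)"
    "ubar (z, 0) < ereal y \<Longrightarrow> ubar (x, t) < ereal y"
    "ubar (z, 0) > ereal y \<Longrightarrow> ubar (x, t) > ereal y"
proof -
  define m where "m = real CARD('n) - 1"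
  have m: "1 \<le> m" using n by (simp add: m_def)
  obtain w where w: "norm w = 1" "x = norm x *\<^sub>R w" by (rule unit_direction)
  define r where "r s = sqrt ((norm x)\<^sup>2 + 2 * m * (t - s))" for s
  have ubar_cont: "continuous_on (UNIV \<times> {0..}) ubar" using ext by (simp add: extended_flow_def)
  define P where "P s = ubar (r s *\<^sub>R w, s)" for s
  have arg: "0 \<le> (norm x)\<^sup>2 + 2 * m * (t - s)" if "s \<le> t" for s
    using that m by simp
  have same_phase: "(norm (r s *\<^sub>R w))\<^sup>2 + 2 * m * s = (norm x)\<^sup>2 + 2 * m * t" if "s \<le> t" for s
    using arg[OF that] w by (simp add: r_def power_mult_distrib algebra_simps)
  have ph: "phase R lam (r s *\<^sub>R w) s = phase R lam x t" if "s \<le> t" for s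
    unfolding same_phase[OF that, unfolded m_def] ..
  have in_annulus: "r s *\<^sub>R w \<in> evolving_annulus R lam s" if "s \<le> t" for s
    using x unfolding evolving_annulus_iff[OF lam] ph[OF that] .
  have avoids: "P s \<noteq> ereal y" if s: "0 \<le> s" "s \<le> t" for s
  proof
    assume P: "P s = ereal y"
    then have "(r s *\<^sub>R w, s) \<in> {p \<in> UNIV \<times> {0..}. -\<infinity> < ubar p \<and> ubar p < \<infinity>}"
      using s by (simp add: P_def)
    then have mem: "(r s *\<^sub>R w, s) \<in> \<Omega>"
      using ext unfolding extended_flow_def by blast
    then have "P s = ereal (u (r s *\<^sub>R w, s))"
      using ext unfolding P_def extended_flow_def by blast
    then have u: "u (r s *\<^sub>R w, s) = y" using P by simp
    have "cos (phase R lam (r s *\<^sub>R w) s) < exp (g s) * oval lam a b (u (r s *\<^sub>R w, s))"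
      unfolding g_def
      by (rule oval_avoidance[OF n R lam a b drift flow t(2) _ _ in_annulus[OF s(2)] mem s])
        (use small init in \<open>auto simp: g_def\<close>)
    also have "\<dots> \<le> exp (g t) * oval lam a b y"
    proof -
      have "f s \<le> f t" using drift s t m by (intro admissible_drift_mono[OF drift]) (auto simp: m_def)
      then have "g s \<le> g t" unfolding g_def using s lam by (intro add_mono mult_left_mono) auto
      then show ?thesis using u oval_pos[OF a b, of lam y] by (intro mult_mono) auto
    qed
    finally show False using y unfolding ph[OF s(2)] by simp
  qed
  have "continuous_on {0..t} P"
    unfolding P_def r_def
    by (rule continuous_on_compose2[OF ubar_cont]) (auto intro!: continuous_intros)
  then have conn: "connected (P ` {0..t})" by (intro connected_continuous_image) auto
  have ends: "P 0 \<in> P ` {0..t}" "P t \<in> P ` {0..t}" using t by auto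
  have avoid: "ereal y \<notin> P ` {0..t}" using avoids by force
  have Pt: "P t = ubar (x, t)" using w(2) by (simp add: P_def r_def)
  have r0: "r 0 \<ge> 0" "norm (r 0 *\<^sub>R w) = r 0" using arg[of 0] t w by (simp_all add: r_def)
  show thesis
  proof (rule that[of "r 0 *\<^sub>R w"])
    show "r 0 *\<^sub>R w \<in> evolving_annulus R lam 0" using in_annulus t by simp
    show "norm (r 0 *\<^sub>R w) = sqrt ((norm x)\<^sup>2 + 2 * (real CARD('n) - 1) * t)"
      using r0 by (simp add: r_def m_def)
    show "ubar (x, t) < ereal y" if "ubar (r 0 *\<^sub>R w, 0) < ereal y"
    proof (rule ccontr)
      assume "\<not> ?thesis"
      then have "ereal y \<in> {P 0..P t}" using that unfolding Pt by (simp add: P_def not_less less_imp_le)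
      then show False using connected_contains_Icc[OF conn ends] avoid by blast
    qed
    show "ubar (x, t) > ereal y" if "ubar (r 0 *\<^sub>R w, 0) > ereal y"
    proof (rule ccontr)
      assume "\<not> ?thesis"
      then have "ereal y \<in> {P t..P 0}" using that unfolding Pt by (simp add: P_def not_less less_imp_le)
      then show False using connected_contains_Icc[OF conn ends(2,1)] avoid by blast
    qed
  qed
qed

text \<open>Points strictly above the grim reaper lie inside an oval whose lower end has the same coefficient and
whose upper end is far enough away.\<close>

lemma oval_through_point:
  fixes E lam M y c :: real
  assumes E: "0 < E" and above: "E * (exp (lam * M) * exp (- (lam * y))) < c"
  obtains b where "0 < b" "4 * exp (lam * M) * b * E\<^sup>2 < 1" "E * oval lam (exp (lam * M)) b y \<le> c"
proof -
  let ?a = "exp (lam * M)"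
  define \<delta> where "\<delta> = c - E * (?a * exp (- (lam * y)))"
  define b where "b = min (\<delta> / (E * exp (lam * y))) (1 / (8 * ?a * E\<^sup>2))"
  have "0 < \<delta>" using above by (simp add: \<delta>_def)
  then have b: "0 < b" using E by (simp add: b_def)
  have "b \<le> 1 / (8 * ?a * E\<^sup>2)" by (simp add: b_def)
  then have "b * (8 * ?a * E\<^sup>2) \<le> 1" using E by (simp add: pos_le_divide_eq)
  then have "4 * ?a * b * E\<^sup>2 < 1" by (simp add: algebra_simps)
  moreover have "b \<le> \<delta> / (E * exp (lam * y))" by (simp add: b_def)
  then have "b * (E * exp (lam * y)) \<le> \<delta>" using E by (simp add: pos_le_divide_eq)
  then have "E * oval lam ?a b y \<le> c" by (simp add: oval_def \<delta>_def algebra_simps)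
  ultimately show thesis using that b by blast
qed

text \<open>A height \<open>y\<close> above the barrier lies inside an oval that is initially above the graph. The value \<open>y\<close> is
therefore not crossed, and at time \<open>0\<close> the graph is below it.\<close>

lemma annulus_barrier_above:
  fixes u :: "(real^'n) \<times> real \<Rightarrow> real" and R lam M t :: real and f f' :: "real \<Rightarrow> real"
  assumes n: "CARD('n) \<ge> 2" and R: "R > 0" and lam: "lam > 0"
    and drift: "admissible_drift (real CARD('n) - 1) R lam f f'"
    and flow: "mcf_without_singularities u0 \<Omega>0 u \<Omega>" and ext: "extended_flow u \<Omega> ubar"
    and A0: "evolving_annulus R lam 0 \<subseteq> \<Omega>0"
    and init: "\<And>x. x \<in> evolving_annulus R lam 0 \<Longrightarrow> u (x, 0) \<le> M - 1 / lam * ln (cos (lam * (norm x - R)))"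
    and t: "0 \<le> t" "2 * (real CARD('n) - 1) * t \<le> R\<^sup>2"
    and x: "x \<in> evolving_annulus R lam t"
  shows "ubar (x, t) \<le> ereal (M - 1 / lam * ln (cos (phase R lam x t)) + lam * t + f t)"
    (is "_ \<le> ereal ?w")
proof (rule ccontr)
  assume "\<not> ?thesis"
  then have "ereal ?w < ubar (x, t)" by (simp only: not_le)
  from ereal_dense2[OF this] obtain y where y: "?w < y" "ereal y < ubar (x, t)"
    by (auto simp only: less_ereal.simps)
  have cos_pos: "0 < cos (phase R lam z s)" if "z \<in> evolving_annulus R lam s" for z :: "real^'n" and s
    using that unfolding evolving_annulus_iff[OF lam] by (intro cos_gt_zero_pi) auto
  let ?g = "\<lambda>t. lam\<^sup>2 * t + lam * f t"
  have "lam * ?w < lam * y" using y lam by simp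
  then have "?g t + lam * M - lam * y < ln (cos (phase R lam x t))"
    using lam by (simp add: algebra_simps power2_eq_square)
  then have "exp (?g t + lam * M - lam * y) < cos (phase R lam x t)"
    using cos_pos[OF x] by (metis exp_less_cancel_iff exp_ln)
  then have "exp (?g t) * (exp (lam * M) * exp (- (lam * y))) < cos (phase R lam x t)"
    by (simp add: exp_diff exp_add exp_minus field_simps)
  then obtain b where b: "0 < b" "4 * exp (lam * M) * b * (exp (?g t))\<^sup>2 < 1"
      "exp (?g t) * oval lam (exp (lam * M)) b y \<le> cos (phase R lam x t)"
    by (rule oval_through_point[OF exp_gt_zero])
  have below: "cos (lam * (norm z - R)) \<le> exp (lam * M) * exp (- (lam * u (z, 0)))"
    if "z \<in> evolving_annulus R lam 0" for z
  proof -
    have pos: "0 < cos (lam * (norm z - R))" using cos_pos[OF that] by simp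
    have "lam * u (z, 0) \<le> lam * (M - 1 / lam * ln (cos (lam * (norm z - R))))"
      using init[OF that] lam by (intro mult_left_mono) auto
    then have "ln (cos (lam * (norm z - R))) \<le> lam * M - lam * u (z, 0)"
      using lam by (simp add: algebra_simps)
    then have "cos (lam * (norm z - R)) \<le> exp (lam * M - lam * u (z, 0))"
      using pos by (metis exp_le_cancel_iff exp_ln)
    then show ?thesis by (simp add: exp_diff exp_minus field_simps)
  qed
  have init_oval: "cos (lam * (norm z - R)) < oval lam (exp (lam * M)) b (u (z, 0))"
    if "z \<in> evolving_annulus R lam 0" for z
    using below[OF that] b(1) unfolding oval_def by (smt (verit) exp_gt_zero mult_pos_pos)
  obtain z where z: "z \<in> evolving_annulus R lam 0" "norm z = sqrt ((norm x)\<^sup>2 + 2 * (real CARD('n) - 1) * t)"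
    "ubar (z, 0) < ereal y \<Longrightarrow> ubar (x, t) < ereal y"
    using oval_level_not_crossed[OF n R lam exp_gt_zero b(1) drift flow ext t b(2) init_oval x b(3)]
    by blast
  have "(z, 0) \<in> \<Omega>" using z(1) A0 flow unfolding mcf_without_singularities_def time_slice_def by blast
  then have uz: "ubar (z, 0) = ereal (u (z, 0))" using ext by (simp add: extended_flow_def)
  have "exp (lam * M) * exp (- (lam * y)) \<le> exp (?g t) * (exp (lam * M) * exp (- (lam * y)))"
  proof -
    have "f 0 \<le> f t" using n t by (intro admissible_drift_mono[OF drift]) auto
    moreover have "f 0 = 0" using drift by (simp add: admissible_drift_def)
    ultimately have "0 \<le> ?g t" using lam t by simp
    then show ?thesis by simp
  qed
  also have "\<dots> < cos (lam * (norm z - R))"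
    unfolding z(2) by fact
  also have "\<dots> \<le> exp (lam * M) * exp (- (lam * u (z, 0)))" by (rule below[OF z(1)])
  finally have "u (z, 0) < y" using lam by simp
  then show False using z(3) uz y(2) by auto
qed

text \<open>Ovals are compact, so the reflected ones bound the graph from below by the same argument. The height
\<open>- y\<close> is chosen so low that it lies inside such an oval at time \<open>t\<close> and below the graph at time \<open>0\<close>.\<close>

lemma annulus_barrier_below:
  fixes u :: "(real^'n) \<times> real \<Rightarrow> real" and R lam M t :: real and f f' :: "real \<Rightarrow> real"
  assumes n: "CARD('n) \<ge> 2" and R: "R > 0" and lam: "lam > 0"
    and drift: "admissible_drift (real CARD('n) - 1) R lam f f'"
    and flow: "mcf_without_singularities u0 \<Omega>0 u \<Omega>" and ext: "extended_flow u \<Omega> ubar"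
    and A0: "evolving_annulus R lam 0 \<subseteq> \<Omega>0"
    and init: "\<And>x. x \<in> evolving_annulus R lam 0 \<Longrightarrow> - M \<le> u (x, 0)"
    and t: "0 \<le> t" "2 * (real CARD('n) - 1) * t \<le> R\<^sup>2"
    and x: "x \<in> evolving_annulus R lam t"
  shows "-\<infinity> < ubar (x, t)"
proof -
  let ?c = "cos (phase R lam x t)"
  let ?g = "\<lambda>t. lam\<^sup>2 * t + lam * f t"
  have c: "0 < ?c" using x unfolding evolving_annulus_iff[OF lam] by (intro cos_gt_zero_pi) auto
  define y where "y = max M ((?g t + lam * M - ln ?c) / lam) + 1"
  have y: "M < y" "(?g t + lam * M - ln ?c) / lam < y" by (auto simp: y_def)
  then have "?g t + lam * M - lam * y < ln ?c" using lam by (simp add: pos_divide_less_eq algebra_simps)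
  then have "exp (?g t + lam * M - lam * y) < ?c" using c by (metis exp_less_cancel_iff exp_ln)
  then have "exp (?g t) * (exp (lam * M) * exp (- (lam * y))) < ?c"
    by (simp add: exp_diff exp_add exp_minus field_simps)
  then obtain b where b: "0 < b" "4 * exp (lam * M) * b * (exp (?g t))\<^sup>2 < 1"
      "exp (?g t) * oval lam (exp (lam * M)) b y \<le> ?c"
    by (rule oval_through_point[OF exp_gt_zero])
  have flip: "oval lam b (exp (lam * M)) z = oval lam (exp (lam * M)) b (- z)" for z
    by (simp add: oval_def)
  have init_oval: "cos (lam * (norm z - R)) < oval lam b (exp (lam * M)) (u (z, 0))"
    if "z \<in> evolving_annulus R lam 0" for z
  proof -
    have "0 \<le> lam * M + lam * u (z, 0)"
      using init[OF that] lam by (simp flip: distrib_left)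
    then have "1 \<le> exp (lam * M) * exp (lam * u (z, 0))" by (simp flip: exp_add)
    moreover have "0 < b * exp (- (lam * u (z, 0)))" using b by simp
    ultimately show ?thesis using cos_le_one[of "lam * (norm z - R)"] unfolding oval_def by linarith
  qed
  have b2: "4 * b * exp (lam * M) * (exp (?g t))\<^sup>2 < 1" using b(2) by (simp add: ac_simps)
  have b3: "exp (?g t) * oval lam b (exp (lam * M)) (- y) \<le> ?c" using b(3) by (simp add: flip)
  obtain z where z: "z \<in> evolving_annulus R lam 0"
    "ubar (z, 0) > ereal (- y) \<Longrightarrow> ubar (x, t) > ereal (- y)"
    using oval_level_not_crossed[OF n R lam b(1) exp_gt_zero drift flow ext t b2 init_oval x b3]
    by blast
  have "(z, 0) \<in> \<Omega>" using z(1) A0 flow unfolding mcf_without_singularities_def time_slice_def by blast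
  then have "ubar (z, 0) = ereal (u (z, 0))" using ext by (simp add: extended_flow_def)
  then have "ereal (- y) < ubar (x, t)" using z(2) init[OF z(1)] y(1) by simp
  then show ?thesis by (rule le_less_trans[rotated]) simp
qed

section \<open>The annulus stays in the domain\<close>

lemma closed_annulus_subset_closure:
  assumes R: "R > 0" and lam: "lam > 0"
  shows "{x::real^'n. \<bar>norm x - R\<bar> \<le> pi / (2 * lam)} \<subseteq> closure (evolving_annulus R lam 0)"
proof
  fix x :: "real^'n"
  define l where "l = pi / (2 * lam)"
  assume "x \<in> {x. \<bar>norm x - R\<bar> \<le> pi / (2 * lam)}"
  then have x: "\<bar>norm x - R\<bar> \<le> l" by (simp add: l_def)
  have l: "0 < l" using lam by (simp add: l_def)
  obtain w where w: "norm w = 1" "x = norm x *\<^sub>R w" by (rule unit_direction)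
  show "x \<in> closure (evolving_annulus R lam 0)"
    unfolding closure_approachable
  proof (intro allI impI)
    fix e :: real assume e: "0 < e"
    define \<mu> where "\<mu> = min 1 (e / (2 * l))"
    have mu: "0 < \<mu>" "\<mu> \<le> 1" "\<mu> * l < e"
    proof -
      have "\<mu> * l \<le> e / (2 * l) * l" using l by (intro mult_right_mono) (auto simp: \<mu>_def)
      then show "\<mu> * l < e" using l e by simp
    qed (use e l in \<open>auto simp: \<mu>_def\<close>)
    define r where "r = norm x + \<mu> * (R - norm x)"
    have "r - R = (1 - \<mu>) * (norm x - R)" by (simp add: r_def algebra_simps)
    then have "\<bar>r - R\<bar> = (1 - \<mu>) * \<bar>norm x - R\<bar>" using mu by (simp add: abs_mult)
    also have "\<dots> \<le> (1 - \<mu>) * l" using x mu by (intro mult_left_mono) auto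
    also have "\<dots> < l" using mu l by (simp add: algebra_simps)
    finally have rR: "\<bar>r - R\<bar> < l" .
    have "r = (1 - \<mu>) * norm x + \<mu> * R" by (simp add: r_def algebra_simps)
    then have r0: "0 \<le> r" using mu R by simp
    have "r *\<^sub>R w \<in> evolving_annulus R lam 0"
      using rR r0 w unfolding evolving_annulus_def l_def by (simp add: abs_less_iff)
    moreover have "dist (r *\<^sub>R w) x < e"
    proof -
      have "r *\<^sub>R w - x = (r - norm x) *\<^sub>R w" using w(2) by (simp add: scaleR_diff_left)
      then have "dist (r *\<^sub>R w) x = \<bar>r - norm x\<bar>" using w(1) by (simp add: dist_norm)
      also have "\<dots> = \<mu> * \<bar>norm x - R\<bar>" using mu by (simp add: r_def abs_mult abs_minus_commute)
      also have "\<dots> \<le> \<mu> * l" using x mu by (intro mult_left_mono) auto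
      finally show ?thesis using mu by linarith
    qed
    ultimately show "\<exists>y\<in>evolving_annulus R lam 0. dist y x < e" by blast
  qed
qed

lemma compact_closed_annulus: "compact {x::real^'n. \<bar>norm x - R\<bar> \<le> l}"
proof -
  have "bounded {x::real^'n. \<bar>norm x - R\<bar> \<le> l}"
    by (rule bounded_subset[OF bounded_cball[of 0 "R + l"]]) auto
  moreover have "closed {x::real^'n. \<bar>norm x - R\<bar> \<le> l}"
    by (intro closed_Collect_le continuous_intros)
  ultimately show ?thesis by (simp add: compact_eq_bounded_closed)
qed

lemma wider_annulus_in_open:
  fixes U :: "(real^'n) set"
  assumes "open U" and sub: "{x. \<bar>norm x - R\<bar> \<le> l} \<subseteq> U"
  obtains e where "0 < e" "{x. \<bar>norm x - R\<bar> \<le> l + e} \<subseteq> U"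
proof -
  define N where "N = {x. \<bar>norm x - R\<bar> \<le> l + 1} - U"
  have "compact N" unfolding N_def by (intro compact_diff compact_closed_annulus \<open>open U\<close>)
  show thesis
  proof (cases "N = {}")
    case True
    then show thesis using that[of 1] by (auto simp: N_def)
  next
    case False
    then have "\<exists>x0\<in>N. \<forall>x\<in>N. \<bar>norm x0 - R\<bar> \<le> \<bar>norm x - R\<bar>"
      by (intro continuous_attains_inf continuous_intros \<open>compact N\<close>)
    then obtain x0 where x0: "x0 \<in> N" "\<And>x. x \<in> N \<Longrightarrow> \<bar>norm x0 - R\<bar> \<le> \<bar>norm x - R\<bar>"
      by blast
    have gap: "l < \<bar>norm x0 - R\<bar>" using x0(1) sub by (force simp: N_def)
    show thesis
    proof (rule that[of "min 1 ((\<bar>norm x0 - R\<bar> - l) / 2)"])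
      show "{x. \<bar>norm x - R\<bar> \<le> l + min 1 ((\<bar>norm x0 - R\<bar> - l) / 2)} \<subseteq> U"
      proof
        fix x :: "real^'n" assume x: "x \<in> {x. \<bar>norm x - R\<bar> \<le> l + min 1 ((\<bar>norm x0 - R\<bar> - l) / 2)}"
        show "x \<in> U"
        proof (rule ccontr)
          assume "x \<notin> U"
          then have "x \<in> N" using x by (auto simp: N_def)
          from x0(2)[OF this] have "\<bar>norm x0 - R\<bar> \<le> \<bar>norm x - R\<bar>" .
          also have "\<dots> \<le> l + (\<bar>norm x0 - R\<bar> - l) / 2" using x by simp
          finally show False using gap by (simp add: field_simps)
        qed
      qed
    qed (use gap in simp)
  qed
qed

text \<open>The closure of the annulus is contained in the annulus for a smaller parameter \<open>lam'\<close>, chosen so close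
to \<open>lam\<close> that the wider annulus still lies initially in a compact part of \<open>\<Omega>0\<close>. There \<open>u\<close> is initially
bounded by some \<open>M\<close>, and the barriers from both sides keep the extended function finite.\<close>

lemma annulus_stays_in_domain:
  fixes u :: "(real^'n) \<times> real \<Rightarrow> real"
  assumes n: "CARD('n) \<ge> 2" and R: "R > 0" and lam: "lam > 0"
    and flow: "mcf_without_singularities u0 \<Omega>0 u \<Omega>"
    and A0: "evolving_annulus R lam 0 \<Subset> \<Omega>0"
    and t: "0 \<le> t" "2 * (real CARD('n) - 1) * t \<le> R\<^sup>2"
  shows "evolving_annulus R lam t \<Subset> time_slice \<Omega> t"
proof -
  define l where "l = pi / (2 * lam)"
  have l: "0 < l" using lam by (simp add: l_def)
  have cnt: "continuous_on \<Omega> u" and slice: "time_slice \<Omega> 0 = \<Omega>0" and "open \<Omega>0"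
    using flow by (auto simp: mcf_without_singularities_def mcf_initial_data_def)
  obtain ubar where ext: "extended_flow u \<Omega> ubar"
    using flow unfolding mcf_without_singularities_def extended_flow_def by blast
  have "{x. \<bar>norm x - R\<bar> \<le> l} \<subseteq> \<Omega>0"
    using closed_annulus_subset_closure[OF R lam, where 'n='n] A0
    unfolding compactly_contained_def l_def by blast
  then obtain e where e: "0 < e" "{x. \<bar>norm x - R\<bar> \<le> l + e} \<subseteq> \<Omega>0"
    by (rule wider_annulus_in_open[OF \<open>open \<Omega>0\<close>])
  define lam' where "lam' = pi / (2 * (l + e))"
  have lam': "0 < lam'" "pi / (2 * lam') = l + e" using l e by (simp_all add: lam'_def)
  have wide: "x \<in> evolving_annulus R lam' s \<longleftrightarrow>
      \<bar>sqrt ((norm x)\<^sup>2 + 2 * (real CARD('n) - 1) * s) - R\<bar> < l + e" for x :: "real^'n" and s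
    unfolding evolving_annulus_def lam'(2) by (auto simp: abs_less_iff)
  have wide0: "(evolving_annulus R lam' 0 :: (real^'n) set) \<subseteq> {x. \<bar>norm x - R\<bar> \<le> l + e}"
    using wide[where s = 0] by (auto simp: less_imp_le)

  have "continuous_on {x. \<bar>norm x - R\<bar> \<le> l + e} (\<lambda>x. u (x, 0))"
    using e(2) slice
    by (intro continuous_on_compose2[OF cnt] continuous_intros) (auto simp: time_slice_def)
  from compact_imp_bounded[OF compact_continuous_image[OF this compact_closed_annulus]]
  obtain M where M: "\<And>x. \<bar>norm x - R\<bar> \<le> l + e \<Longrightarrow> \<bar>u (x, 0)\<bar> \<le> M"
    unfolding bounded_iff by auto

  \<comment> \<open>For finiteness any admissible drift for the wider annulus will do.\<close>
  define k where "k = sqrt (2 * lam' / (pi * R))"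
  have drift: "admissible_drift (real CARD('n) - 1) R lam' (\<lambda>t. k * t) (\<lambda>_. k)"
    unfolding k_def using n by (intro linear_drift_admissible R lam') auto
  have A0': "evolving_annulus R lam' 0 \<subseteq> \<Omega>0" using wide0 e(2) by blast
  have below: "- M \<le> u (x, 0)" if "x \<in> evolving_annulus R lam' 0" for x
    using M[of x] that wide0 by fastforce
  have above: "u (x, 0) \<le> M - 1 / lam' * ln (cos (lam' * (norm x - R)))"
    if "x \<in> evolving_annulus R lam' 0" for x
  proof -
    have "u (x, 0) \<le> M" using M[of x] that wide0 by fastforce
    moreover have "0 < cos (lam' * (norm x - R))"
      using that evolving_annulus_iff[OF lam'(1), of x R 0] by (intro cos_gt_zero_pi) auto
    then have "1 / lam' * ln (cos (lam' * (norm x - R))) \<le> 0"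
      using lam' by (intro mult_nonneg_nonpos) (auto simp: ln_le_zero_iff)
    ultimately show ?thesis by linarith
  qed
  have inside: "evolving_annulus R lam' t \<subseteq> time_slice \<Omega> t"
  proof
    fix x :: "real^'n" assume x: "x \<in> evolving_annulus R lam' t"
    have "-\<infinity> < ubar (x, t)"
      by (rule annulus_barrier_below[OF n R lam'(1) drift flow ext A0' below t x])
    moreover have "ubar (x, t) < \<infinity>"
      using annulus_barrier_above[OF n R lam'(1) drift flow ext A0' above t x]
      by (cases "ubar (x, t)") auto
    ultimately have "(x, t) \<in> {p \<in> UNIV \<times> {0..}. -\<infinity> < ubar p \<and> ubar p < \<infinity>}"
      using t by simp
    then show "x \<in> time_slice \<Omega> t" using ext unfolding extended_flow_def time_slice_def by blast
  qed

  define A where "A = {x::real^'n. \<bar>sqrt ((norm x)\<^sup>2 + 2 * (real CARD('n) - 1) * t) - R\<bar> \<le> l}"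
  have "closed A" unfolding A_def by (intro closed_Collect_le continuous_intros)
  moreover have "evolving_annulus R lam t \<subseteq> A"
    unfolding evolving_annulus_def A_def l_def by (auto simp: abs_le_iff)
  ultimately have cl: "closure (evolving_annulus R lam t) \<subseteq> A" by (intro closure_minimal)
  moreover have "A \<subseteq> evolving_annulus R lam' t" using wide e(1) by (auto simp: A_def)
  moreover have "bounded A"
  proof (rule bounded_subset[OF bounded_cball[of 0 "R + l"]])
    show "A \<subseteq> cball 0 (R + l)"
    proof
      fix x assume x: "x \<in> A"
      have "norm x \<le> sqrt ((norm x)\<^sup>2 + 2 * (real CARD('n) - 1) * t)"
        using t n by (intro real_le_rsqrt) auto
      then show "x \<in> cball 0 (R + l)" using x by (auto simp: A_def)
    qed
  qed
  ultimately show ?thesis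
    using inside bounded_subset[OF \<open>bounded A\<close> cl] unfolding compactly_contained_def
    by (auto simp: compact_eq_bounded_closed)
qed

theorem theorem11:
  fixes R lam :: real
    and u0 :: "real^'n \<Rightarrow> real" and \<Omega>0 :: "(real^'n) set"
    and u :: "(real^'n) \<times> real \<Rightarrow> real" and \<Omega> :: "((real^'n) \<times> real) set"
  assumes "CARD('n) \<ge> 2"
    and "R > 0" and "lam > 0"
    and "mcf_without_singularities u0 \<Omega>0 u \<Omega>"
    and "evolving_annulus R lam 0 \<Subset> \<Omega>0"
    and "\<forall>x \<in> evolving_annulus R lam 0.
           u (x, 0) \<le> - (1 / lam) * ln (cos (lam * (norm x - R)))"
  shows "\<forall>f \<in> {\<lambda>t. sqrt (2 * lam / (pi * R)) * t,
                \<lambda>t. 2 * (R + pi / (4 * lam)) / (real CARD('n) - 1) *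
                     (- ln (sin (1/4 * (1 - 2 * (real CARD('n) - 1) * t / (R + pi / (4 * lam))\<^sup>2)))
                      + ln (sin (1/4)))}.
         \<forall>t \<in> {0 .. R\<^sup>2 / (2 * (real CARD('n) - 1))}.
           evolving_annulus R lam t \<Subset> time_slice \<Omega> t \<and>
           (\<forall>x \<in> evolving_annulus R lam t.
              u (x, t) \<le> - (1 / lam) *
                  ln (cos (lam * (sqrt ((norm x)\<^sup>2 + 2 * (real CARD('n) - 1) * t) - R)))
                + lam * t + f t)"
proof (intro ballI conjI)
  note n = assms(1) and R = assms(2) and lam = assms(3) and flow = assms(4)
  fix f :: "real \<Rightarrow> real" and t :: real
  assume f: "f \<in> {\<lambda>t. sqrt (2 * lam / (pi * R)) * t,
                \<lambda>t. 2 * (R + pi / (4 * lam)) / (real CARD('n) - 1) *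
                     (- ln (sin (1/4 * (1 - 2 * (real CARD('n) - 1) * t / (R + pi / (4 * lam))\<^sup>2)))
                      + ln (sin (1/4)))}"
    and "t \<in> {0 .. R\<^sup>2 / (2 * (real CARD('n) - 1))}"
  have m: "0 < real CARD('n) - 1" using n by simp
  then have t: "0 \<le> t" "2 * (real CARD('n) - 1) * t \<le> R\<^sup>2"
    using \<open>t \<in> _\<close> by (auto simp: pos_le_divide_eq mult.commute)
  show contained: "evolving_annulus R lam t \<Subset> time_slice \<Omega> t"
    by (rule annulus_stays_in_domain[OF n R lam flow assms(5) t])
  obtain f' where drift: "admissible_drift (real CARD('n) - 1) R lam f f'"
    using f linear_drift_admissible[OF m R lam] log_sin_drift_admissible[OF m R lam] by blast
  fix x :: "real^'n" assume x: "x \<in> evolving_annulus R lam t"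
  obtain ubar where ext: "extended_flow u \<Omega> ubar"
    using flow unfolding mcf_without_singularities_def extended_flow_def by blast
  have A0: "evolving_annulus R lam 0 \<subseteq> \<Omega>0"
    using assms(5) closure_subset unfolding compactly_contained_def by blast
  have init: "u (x, 0) \<le> 0 - 1 / lam * ln (cos (lam * (norm x - R)))"
    if "x \<in> evolving_annulus R lam 0" for x using assms(6) that by simp
  have "(x, t) \<in> \<Omega>"
    using contained x closure_subset unfolding compactly_contained_def time_slice_def by blast
  then have "ubar (x, t) = ereal (u (x, t))" using ext by (simp add: extended_flow_def)
  then show "u (x, t) \<le> - (1 / lam) *
                  ln (cos (lam * (sqrt ((norm x)\<^sup>2 + 2 * (real CARD('n) - 1) * t) - R)))
                + lam * t + f t"
    using annulus_barrier_above[OF n R lam drift flow ext A0 init t x] by simp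
qed

end
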